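(* Let $(\mu,l_{\circ},r_{\circ},\alpha,\beta,V)$ be a representation of a relative PCA algebra $(A,\cdot,\circ,P,Q)$. Let $\hat A=A\ltimes_{-\mu^{*},r^{*}_{\circ}-l^{*}_{\circ},r^{*}_{\circ}}V^{*}$ be the semi-direct product, i.e. $A\oplus V^{*}$ with $$(x+u^* )\cdot(y+v^* )=x\cdot y-\mu^*(x)v^*-\mu^*(y)u^*,\qquad (x+u^* )\circ(y+v^* )=x\circ y+(r_\circ^*-l_\circ^* )(x)v^*+r_\circ^*(y)u^*,$$ so that $(\hat A,P+\beta^{*},Q+\alpha^{*})$ is a relative PCA algebra. Let $T:V\rightarrow A$ be a linear map, identified with an element of $V^{*}\otimes A\subset\hat A\otimes\hat A$. Then $r=T-\tau(T)$ is a solution of the RPCA-YBE in the relative PCA algebra $(\hat A,P+\beta^{*},Q+\alpha^{*})$ if and only if $T$ is an $\mathcal{O}$-operator of $(A,\cdot,\circ,P,Q)$ associated to $(\mu,l_{\circ},r_{\circ},\alpha,\beta,V)$.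
   Context: All vector spaces are finite-dimensional over an algebraically closed field $\mathbb K$ of characteristic zero. For $f:A\rightarrow \mathrm{End}_{\mathbb K}(V)$, $f^{*}:A\rightarrow\mathrm{End}_{\mathbb K}(V^{*})$ is defined by $\langle f^{*}(x)u^{*},v\rangle=-\langle u^{*},f(x)v\rangle$; $\alpha^*,\beta^*$ are transposes (no sign). $\tau(X\otimes Y)=Y\otimes X$. A linear map $T:V\to A$ is identified with the element $T\in V^*\otimes A$ with $\langle T,v\otimes a^*\rangle=\langle T(v),a^*\rangle$, i.e. $T=\sum_i v_i^*\otimes T(v_i)$ for a basis $\{v_i\}$ of $V$ with dual basis $\{v_i^*\}$. Relative Poisson algebra: $(A,\cdot,[-,-],P)$ with $(A,\cdot)$ commutative associative, $(A,[-,-])$ a Lie algebra, $P$ a derivation of both, and $[z,x\cdot y]=[z,x]\cdot y+x\cdot[z,y]+x\cdot y\cdot P(z)$. Anti-pre-Lie algebra: $(A,\circ)$ such that, with $[x,y]=x\circ y-y\circ x$, $x\circ(y\circ z)-y\circ(x\circ z)=[y,x]\circ z$ and $[x,y]\circ z+[y,z]\circ x+[z,x]\circ y=0$; $(A,[-,-])$ is then a Lie algebra (the sub-adjacent Lie algebra). Relative PCA algebra: $(A,\cdot,\circ,P,Q)$ with $(A,\cdot)$ commutative associative, $(A,\circ)$ anti-pre-Lie with sub-adjacent Lie algebra $(A,[-,-])$, $P,Q:A\to A$ linear, $(A,\cdot,[-,-],P)$ a relative Poisson algebra, and: $x\cdot Q(y)-P(x)\cdot y-Q(x\cdot y)=0$;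 $x\circ Q(y)-P(x)\circ y-Q(x\circ y)=0$; $x\cdot(y\circ z)-y\circ(x\cdot z)+[x,y]\cdot z-x\cdot P(y)\cdot z=0$; $(x\cdot y)\circ z-y\circ(x\cdot z)-x\circ(y\cdot z)+Q(x\cdot y\cdot z)=0$ for all $x,y,z$. A representation of $(A,\cdot,\circ,P,Q)$ is a tuple $(\mu,l_{\circ},r_{\circ},\alpha,\beta,V)$ of linear maps $\mu,l_{\circ},r_{\circ}:A\rightarrow\mathrm{End}_{\mathbb K}(V)$, $\alpha,\beta:V\to V$ such that $(A\oplus V,\cdot,\circ,P+\alpha,Q+\beta)$ is a relative PCA algebra, where $(x+u)\cdot(y+v)=x\cdot y+\mu(x)v+\mu(y)u$ and $(x+u)\circ(y+v)=x\circ y+l_{\circ}(x)v+r_{\circ}(y)u$. (This is equivalent to the definition by explicit identities.) It is known that then $(-\mu^{*},r^{*}_{\circ}-l^{*}_{\circ},r^{*}_{\circ},\beta^{*},\alpha^{*},V^{*})$ is also a representation, so $(\hat A,P+\beta^*,Q+\alpha^* )$ is a relative PCA algebra. RPCA-YBE (relative PCA Yang-Baxter equation) in a relative PCA algebra $(A,\cdot,\circ,P,Q)$: for $r=\sum_i a_i\otimes b_i\in A\otimes A$ put $\mathbf{A}(r)=\sum_{i,j}\big(a_i\cdot a_j\otimes b_i\otimes b_j-a_i\otimes a_j\cdot b_i\otimes b_j+a_i\otimes a_j\otimes b_i\cdot b_j\big)$, $\mathbf{T}(r)=\sum_{i,j}\big(a_i\circ a_j\otimes b_i\otimes b_j+a_i\otimes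 b_i\circ a_j\otimes b_j-a_i\otimes a_j\otimes[b_i,b_j]\big)$. $r$ is a solution if $\mathbf{A}(r)=\mathbf{T}(r)=0$, $(Q\otimes\mathrm{id}-\mathrm{id}\otimes P)r=0$ and $(P\otimes\mathrm{id}-\mathrm{id}\otimes Q)r=0$. An $\mathcal{O}$-operator of $(A,\cdot,\circ,P,Q)$ associated to a representation $(\mu,l_{\circ},r_{\circ},\alpha,\beta,V)$ is a linear map $T:V\to A$ such that for all $u,v\in V$: $T(u)\cdot T(v)=T\big(\mu(T(u))v+\mu(T(v))u\big)$; $T(u)\circ T(v)=T\big(l_{\circ}(T(u))v+r_{\circ}(T(v))u\big)$; $PT=T\alpha$; $QT=T\beta$. *)

theory Defs
  imports
    "HOL-Analysis.Product_Vector"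
    "HOL-Computational_Algebra.Polynomial"
    "HOL-Library.Function_Algebras"
    "HOL-Library.Poly_Mapping"
begin

section \<open>Vector spaces and algebras on a carrier\<close>

text \<open>
  Spaces are carried by a subspace \<open>S\<close> of an ambient type, because the dual space \<open>V\<^sup>*\<close> is a subset
  of the type of all functions on \<open>V\<close>. Values of the operations outside the carrier play no role.
\<close>

locale fd_vector_space_on = vector_space scale
  for scale :: "'k::{field_char_0, alg_closed_field} \<Rightarrow> 'a::ab_group_add \<Rightarrow> 'a" +
  fixes S :: "'a set"
  assumes subspace_carrier: "subspace S"
    and finite_dim_carrier: "\<exists>B. finite B \<and> S = span B"

definition linear_on ::
  "('k \<Rightarrow> 'a \<Rightarrow> 'a) \<Rightarrow> 'a set \<Rightarrow> ('k \<Rightarrow> 'b \<Rightarrow> 'b) \<Rightarrow> 'b set \<Rightarrow> ('a::plus \<Rightarrow> 'b::plus) \<Rightarrow> bool"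
  where "linear_on s\<^sub>1 S\<^sub>1 s\<^sub>2 S\<^sub>2 f \<longleftrightarrow>
    (\<forall>x\<in>S\<^sub>1. f x \<in> S\<^sub>2) \<and>
    (\<forall>x\<in>S\<^sub>1. \<forall>y\<in>S\<^sub>1. f (x + y) = f x + f y) \<and>
    (\<forall>c. \<forall>x\<in>S\<^sub>1. f (s\<^sub>1 c x) = s\<^sub>2 c (f x))"

text \<open>\<open>bilinear_on s S t W f\<close>: \<open>f\<close> is a linear map from \<open>S\<close> to \<open>End W\<close>.\<close>

definition bilinear_on ::
  "('k \<Rightarrow> 'a \<Rightarrow> 'a) \<Rightarrow> 'a set \<Rightarrow> ('k \<Rightarrow> 'b \<Rightarrow> 'b) \<Rightarrow> 'b set \<Rightarrow> ('a::plus \<Rightarrow> 'b::plus \<Rightarrow> 'b) \<Rightarrow> bool"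
  where "bilinear_on s S t W f \<longleftrightarrow>
    (\<forall>x\<in>S. linear_on t W t W (f x)) \<and> (\<forall>u\<in>W. linear_on s S t W (\<lambda>x. f x u))"

locale comm_assoc_algebra_on = fd_vector_space_on scale S
  for scale :: "'k::{field_char_0, alg_closed_field} \<Rightarrow> 'a::ab_group_add \<Rightarrow> 'a" and S +
  fixes dot :: "'a \<Rightarrow> 'a \<Rightarrow> 'a" (infixl "\<cdot>" 70)
  assumes mult_bilinear: "bilinear_on scale S scale S (\<cdot>)"
    and mult_comm: "\<lbrakk>x \<in> S; y \<in> S\<rbrakk> \<Longrightarrow> x \<cdot> y = y \<cdot> x"
    and mult_assoc: "\<lbrakk>x \<in> S; y \<in> S; z \<in> S\<rbrakk> \<Longrightarrow> (x \<cdot> y) \<cdot> z = x \<cdot> (y \<cdot> z)"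

locale lie_algebra_on = fd_vector_space_on scale S
  for scale :: "'k::{field_char_0, alg_closed_field} \<Rightarrow> 'a::ab_group_add \<Rightarrow> 'a" and S +
  fixes bracket :: "'a \<Rightarrow> 'a \<Rightarrow> 'a"
  assumes bracket_bilinear: "bilinear_on scale S scale S bracket"
    and bracket_alternating: "x \<in> S \<Longrightarrow> bracket x x = 0"
    and jacobi: "\<lbrakk>x \<in> S; y \<in> S; z \<in> S\<rbrakk> \<Longrightarrow>
      bracket x (bracket y z) + bracket y (bracket z x) + bracket z (bracket x y) = 0"

locale relative_Poisson_algebra =
  comm_assoc_algebra_on scale S dot + lie_algebra_on scale S bracket
  for scale :: "'k::{field_char_0, alg_closed_field} \<Rightarrow> 'a::ab_group_add \<Rightarrow> 'a" and S
    and dot :: "'a \<Rightarrow> 'a \<Rightarrow> 'a" (infixl "\<cdot>" 70) and bracket :: "'a \<Rightarrow> 'a \<Rightarrow> 'a" +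
  fixes P :: "'a \<Rightarrow> 'a"
  assumes P_linear: "linear_on scale S scale S P"
    and P_derivation_mult: "\<lbrakk>x \<in> S; y \<in> S\<rbrakk> \<Longrightarrow> P (x \<cdot> y) = P x \<cdot> y + x \<cdot> P y"
    and P_derivation_bracket:
      "\<lbrakk>x \<in> S; y \<in> S\<rbrakk> \<Longrightarrow> P (bracket x y) = bracket (P x) y + bracket x (P y)"
    and relative_Leibniz: "\<lbrakk>x \<in> S; y \<in> S; z \<in> S\<rbrakk> \<Longrightarrow>
      bracket z (x \<cdot> y) = bracket z x \<cdot> y + x \<cdot> bracket z y + x \<cdot> y \<cdot> P z"

definition sub_adjacent :: "('a \<Rightarrow> 'a \<Rightarrow> 'a) \<Rightarrow> 'a \<Rightarrow> 'a \<Rightarrow> 'a::minus"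
  where "sub_adjacent circ x y = circ x y - circ y x"

locale anti_pre_Lie_algebra = fd_vector_space_on scale S
  for scale :: "'k::{field_char_0, alg_closed_field} \<Rightarrow> 'a::ab_group_add \<Rightarrow> 'a" and S +
  fixes circ :: "'a \<Rightarrow> 'a \<Rightarrow> 'a" (infixl "\<odot>" 70)
  assumes circ_bilinear: "bilinear_on scale S scale S (\<odot>)"
    and anti_pre_Lie_1: "\<lbrakk>x \<in> S; y \<in> S; z \<in> S\<rbrakk> \<Longrightarrow>
      x \<odot> (y \<odot> z) - y \<odot> (x \<odot> z) = sub_adjacent (\<odot>) y x \<odot> z"
    and anti_pre_Lie_2: "\<lbrakk>x \<in> S; y \<in> S; z \<in> S\<rbrakk> \<Longrightarrow>
      sub_adjacent (\<odot>) x y \<odot> z + sub_adjacent (\<odot>) y z \<odot> x + sub_adjacent (\<odot>) z x \<odot> y = 0"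

locale relative_PCA_algebra =
  anti_pre_Lie_algebra scale S circ +
  relative_Poisson_algebra scale S dot "sub_adjacent circ" P
  for scale :: "'k::{field_char_0, alg_closed_field} \<Rightarrow> 'a::ab_group_add \<Rightarrow> 'a" and S
    and dot :: "'a \<Rightarrow> 'a \<Rightarrow> 'a" (infixl "\<cdot>" 70)
    and circ :: "'a \<Rightarrow> 'a \<Rightarrow> 'a" (infixl "\<odot>" 70)
    and P :: "'a \<Rightarrow> 'a" +
  fixes Q :: "'a \<Rightarrow> 'a"
  assumes Q_linear: "linear_on scale S scale S Q"
    and PQ_mult: "\<lbrakk>x \<in> S; y \<in> S\<rbrakk> \<Longrightarrow> x \<cdot> Q y - P x \<cdot> y - Q (x \<cdot> y) = 0"
    and PQ_circ: "\<lbrakk>x \<in> S; y \<in> S\<rbrakk> \<Longrightarrow> x \<odot> Q y - P x \<odot> y - Q (x \<odot> y) = 0"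
    and PCA_1: "\<lbrakk>x \<in> S; y \<in> S; z \<in> S\<rbrakk> \<Longrightarrow>
      x \<cdot> (y \<odot> z) - y \<odot> (x \<cdot> z) + sub_adjacent (\<odot>) x y \<cdot> z - x \<cdot> P y \<cdot> z = 0"
    and PCA_2: "\<lbrakk>x \<in> S; y \<in> S; z \<in> S\<rbrakk> \<Longrightarrow>
      (x \<cdot> y) \<odot> z - y \<odot> (x \<cdot> z) - x \<odot> (y \<cdot> z) + Q (x \<cdot> y \<cdot> z) = 0"


section \<open>Semi-direct products, representations and duals\<close>

definition semidirect_mult ::
  "('a \<Rightarrow> 'a \<Rightarrow> 'a) \<Rightarrow> ('a \<Rightarrow> 'v \<Rightarrow> 'v) \<Rightarrow> 'a \<times> 'v \<Rightarrow> 'a \<times> 'v \<Rightarrow> 'a \<times> 'v::plus"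
  where "semidirect_mult dot \<mu> =
    (\<lambda>(x, u) (y, v). (dot x y, \<mu> x v + \<mu> y u))"

definition semidirect_circ ::
  "('a \<Rightarrow> 'a \<Rightarrow> 'a) \<Rightarrow> ('a \<Rightarrow> 'v \<Rightarrow> 'v) \<Rightarrow> ('a \<Rightarrow> 'v \<Rightarrow> 'v) \<Rightarrow> 'a \<times> 'v \<Rightarrow> 'a \<times> 'v \<Rightarrow> 'a \<times> 'v::plus"
  where "semidirect_circ circ l r =
    (\<lambda>(x, u) (y, v). (circ x y, l x v + r y u))"

definition relative_PCA_representation ::
  "('k::{field_char_0, alg_closed_field} \<Rightarrow> 'a::ab_group_add \<Rightarrow> 'a) \<Rightarrow> 'a set \<Rightarrow>
   ('a \<Rightarrow> 'a \<Rightarrow> 'a) \<Rightarrow> ('a \<Rightarrow> 'a \<Rightarrow> 'a) \<Rightarrow> ('a \<Rightarrow> 'a) \<Rightarrow> ('a \<Rightarrow> 'a) \<Rightarrow>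
   ('a \<Rightarrow> 'v \<Rightarrow> 'v) \<Rightarrow> ('a \<Rightarrow> 'v \<Rightarrow> 'v) \<Rightarrow> ('a \<Rightarrow> 'v \<Rightarrow> 'v) \<Rightarrow> ('v \<Rightarrow> 'v) \<Rightarrow> ('v \<Rightarrow> 'v) \<Rightarrow>
   ('k \<Rightarrow> 'v::ab_group_add \<Rightarrow> 'v) \<Rightarrow> 'v set \<Rightarrow> bool"
  where "relative_PCA_representation s S dot circ P Q \<mu> l r \<alpha> \<beta> t W \<longleftrightarrow>
    fd_vector_space_on t W \<and>
    bilinear_on s S t W \<mu> \<and> bilinear_on s S t W l \<and> bilinear_on s S t W r \<and>
    linear_on t W t W \<alpha> \<and> linear_on t W t W \<beta> \<and>
    relative_PCA_algebra (module_prod.scale s t) (S \<times> W)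
      (semidirect_mult dot \<mu>) (semidirect_circ circ l r) (map_prod P \<alpha>) (map_prod Q \<beta>)"

definition dual_space :: "('k::field \<Rightarrow> 'v::ab_group_add \<Rightarrow> 'v) \<Rightarrow> ('v \<Rightarrow> 'k) set"
  where "dual_space t = {f. Vector_Spaces.linear t (*) f}"

definition dual_scale :: "'k::times \<Rightarrow> ('v \<Rightarrow> 'k) \<Rightarrow> 'v \<Rightarrow> 'k"
  where "dual_scale c f = (\<lambda>v. c * f v)"

definition dual_rep :: "('a \<Rightarrow> 'v \<Rightarrow> 'v) \<Rightarrow> 'a \<Rightarrow> ('v \<Rightarrow> 'k) \<Rightarrow> 'v \<Rightarrow> 'k::uminus"
  where "dual_rep f x u = (\<lambda>v. - u (f x v))"

definition transpose_map :: "('v \<Rightarrow> 'v) \<Rightarrow> ('v \<Rightarrow> 'k) \<Rightarrow> 'v \<Rightarrow> 'k"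
  where "transpose_map \<phi> u = (\<lambda>v. u (\<phi> v))"


section \<open>Tensor products\<close>

text \<open>
  The tensor square (cube) of the space carried by \<open>S\<close> is the free vector space on \<open>S \<times> S\<close>
  (on \<open>S \<times> S \<times> S\<close>), realised as finitely supported functions, modulo the subspace spanned by the
  multilinearity relations. Its elements are cosets; the zero tensor is that subspace itself.
\<close>

definition free_scale :: "'k::mult_zero \<Rightarrow> ('x \<Rightarrow>\<^sub>0 'k) \<Rightarrow> ('x \<Rightarrow>\<^sub>0 'k)"
  where "free_scale c p = Poly_Mapping.map ((*) c) p"

abbreviation free_gen :: "'x \<Rightarrow> 'x \<Rightarrow>\<^sub>0 'k::zero_neq_one"
  where "free_gen x \<equiv> Poly_Mapping.single x 1"

definition tensor2_null ::
  "('k::field \<Rightarrow> 'a::ab_group_add \<Rightarrow> 'a) \<Rightarrow> 'a set \<Rightarrow> ('a \<times> 'a \<Rightarrow>\<^sub>0 'k) set"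
  where "tensor2_null s S = module.span free_scale (
    {free_gen (x + x', y) - free_gen (x, y) - free_gen (x', y) | x x' y. x \<in> S \<and> x' \<in> S \<and> y \<in> S} \<union>
    {free_gen (x, y + y') - free_gen (x, y) - free_gen (x, y') | x y y'. x \<in> S \<and> y \<in> S \<and> y' \<in> S} \<union>
    {free_gen (s c x, y) - free_scale c (free_gen (x, y)) | c x y. x \<in> S \<and> y \<in> S} \<union>
    {free_gen (x, s c y) - free_scale c (free_gen (x, y)) | c x y. x \<in> S \<and> y \<in> S})"

definition tensor3_null ::
  "('k::field \<Rightarrow> 'a::ab_group_add \<Rightarrow> 'a) \<Rightarrow> 'a set \<Rightarrow> ('a \<times> 'a \<times> 'a \<Rightarrow>\<^sub>0 'k) set"
  where "tensor3_null s S = module.span free_scale (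
    {free_gen (x + x', y, z) - free_gen (x, y, z) - free_gen (x', y, z) | x x' y z.
       x \<in> S \<and> x' \<in> S \<and> y \<in> S \<and> z \<in> S} \<union>
    {free_gen (x, y + y', z) - free_gen (x, y, z) - free_gen (x, y', z) | x y y' z.
       x \<in> S \<and> y \<in> S \<and> y' \<in> S \<and> z \<in> S} \<union>
    {free_gen (x, y, z + z') - free_gen (x, y, z) - free_gen (x, y, z') | x y z z'.
       x \<in> S \<and> y \<in> S \<and> z \<in> S \<and> z' \<in> S} \<union>
    {free_gen (s c x, y, z) - free_scale c (free_gen (x, y, z)) | c x y z. x \<in> S \<and> y \<in> S \<and> z \<in> S} \<union>
    {free_gen (x, s c y, z) - free_scale c (free_gen (x, y, z)) | c x y z. x \<in> S \<and> y \<in> S \<and> z \<in> S} \<union>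
    {free_gen (x, y, s c z) - free_scale c (free_gen (x, y, z)) | c x y z. x \<in> S \<and> y \<in> S \<and> z \<in> S})"

definition coset :: "'f::plus set \<Rightarrow> 'f \<Rightarrow> 'f set"
  where "coset N p = {p + n | n. n \<in> N}"

definition coset_diff :: "'f::minus set \<Rightarrow> 'f set \<Rightarrow> 'f set"
  where "coset_diff X Y = {p - q | p q. p \<in> X \<and> q \<in> Y}"

definition tensor2 ::
  "('k::field \<Rightarrow> 'a::ab_group_add \<Rightarrow> 'a) \<Rightarrow> 'a set \<Rightarrow> ('a \<times> 'a \<Rightarrow>\<^sub>0 'k) set set"
  where "tensor2 s S = coset (tensor2_null s S) ` {p. Poly_Mapping.keys p \<subseteq> S \<times> S}"

text \<open>
  The map into the quotient by \<open>N\<close> induced by a map \<open>F\<close> on representatives. It is meaningful when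
  the class of \<open>F p\<close> does not depend on the representative \<open>p\<close> of the coset; this holds below since
  every \<open>F\<close> is built from linear endomorphisms and bilinear products on the carrier.
\<close>

definition induced :: "'g set \<Rightarrow> ('f \<Rightarrow> 'g::plus) \<Rightarrow> 'f set \<Rightarrow> 'g set"
  where "induced N F X = the_elem ((\<lambda>p. coset N (F p)) ` X)"

definition tensor2_map ::
  "('k::field \<Rightarrow> 'a::ab_group_add \<Rightarrow> 'a) \<Rightarrow> 'a set \<Rightarrow> ('a \<Rightarrow> 'a) \<Rightarrow> ('a \<Rightarrow> 'a) \<Rightarrow>
   ('a \<times> 'a \<Rightarrow>\<^sub>0 'k) set \<Rightarrow> ('a \<times> 'a \<Rightarrow>\<^sub>0 'k) set"
  where "tensor2_map s S \<phi> \<psi> = induced (tensor2_null s S)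
    (\<lambda>p. \<Sum>(a, b)\<in>Poly_Mapping.keys p.
      free_scale (Poly_Mapping.lookup p (a, b)) (free_gen (\<phi> a, \<psi> b)))"

definition tensor2_flip ::
  "('k::field \<Rightarrow> 'a::ab_group_add \<Rightarrow> 'a) \<Rightarrow> 'a set \<Rightarrow>
   ('a \<times> 'a \<Rightarrow>\<^sub>0 'k) set \<Rightarrow> ('a \<times> 'a \<Rightarrow>\<^sub>0 'k) set"
  where "tensor2_flip s S = induced (tensor2_null s S)
    (\<lambda>p. \<Sum>(a, b)\<in>Poly_Mapping.keys p.
      free_scale (Poly_Mapping.lookup p (a, b)) (free_gen (b, a)))"


section \<open>The relative PCA Yang-Baxter equation\<close>

definition YB_A ::
  "('k::field \<Rightarrow> 'a::ab_group_add \<Rightarrow> 'a) \<Rightarrow> 'a set \<Rightarrow> ('a \<Rightarrow> 'a \<Rightarrow> 'a) \<Rightarrow>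
   ('a \<times> 'a \<Rightarrow>\<^sub>0 'k) set \<Rightarrow> ('a \<times> 'a \<times> 'a \<Rightarrow>\<^sub>0 'k) set"
  where "YB_A s S dot = induced (tensor3_null s S)
    (\<lambda>p. \<Sum>(a, b)\<in>Poly_Mapping.keys p. \<Sum>(a', b')\<in>Poly_Mapping.keys p.
      free_scale (Poly_Mapping.lookup p (a, b) * Poly_Mapping.lookup p (a', b'))
        (free_gen (dot a a', b, b') - free_gen (a, dot a' b, b') + free_gen (a, a', dot b b')))"

definition YB_T ::
  "('k::field \<Rightarrow> 'a::ab_group_add \<Rightarrow> 'a) \<Rightarrow> 'a set \<Rightarrow> ('a \<Rightarrow> 'a \<Rightarrow> 'a) \<Rightarrow>
   ('a \<times> 'a \<Rightarrow>\<^sub>0 'k) set \<Rightarrow> ('a \<times> 'a \<times> 'a \<Rightarrow>\<^sub>0 'k) set"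
  where "YB_T s S circ = induced (tensor3_null s S)
    (\<lambda>p. \<Sum>(a, b)\<in>Poly_Mapping.keys p. \<Sum>(a', b')\<in>Poly_Mapping.keys p.
      free_scale (Poly_Mapping.lookup p (a, b) * Poly_Mapping.lookup p (a', b'))
        (free_gen (circ a a', b, b') + free_gen (a, circ b a', b')
          - free_gen (a, a', sub_adjacent circ b b')))"

definition RPCA_YBE_solution ::
  "('k::field \<Rightarrow> 'a::ab_group_add \<Rightarrow> 'a) \<Rightarrow> 'a set \<Rightarrow> ('a \<Rightarrow> 'a \<Rightarrow> 'a) \<Rightarrow> ('a \<Rightarrow> 'a \<Rightarrow> 'a) \<Rightarrow>
   ('a \<Rightarrow> 'a) \<Rightarrow> ('a \<Rightarrow> 'a) \<Rightarrow> ('a \<times> 'a \<Rightarrow>\<^sub>0 'k) set \<Rightarrow> bool"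
  where "RPCA_YBE_solution s S dot circ P Q r \<longleftrightarrow>
    r \<in> tensor2 s S \<and>
    YB_A s S dot r = tensor3_null s S \<and>
    YB_T s S circ r = tensor3_null s S \<and>
    coset_diff (tensor2_map s S Q id r) (tensor2_map s S id P r) = tensor2_null s S \<and>
    coset_diff (tensor2_map s S P id r) (tensor2_map s S id Q r) = tensor2_null s S"


section \<open>O-operators\<close>

definition O_operator ::
  "('k::field \<Rightarrow> 'a::ab_group_add \<Rightarrow> 'a) \<Rightarrow> 'a set \<Rightarrow>
   ('a \<Rightarrow> 'a \<Rightarrow> 'a) \<Rightarrow> ('a \<Rightarrow> 'a \<Rightarrow> 'a) \<Rightarrow> ('a \<Rightarrow> 'a) \<Rightarrow> ('a \<Rightarrow> 'a) \<Rightarrow>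
   ('a \<Rightarrow> 'v \<Rightarrow> 'v) \<Rightarrow> ('a \<Rightarrow> 'v \<Rightarrow> 'v) \<Rightarrow> ('a \<Rightarrow> 'v \<Rightarrow> 'v) \<Rightarrow> ('v \<Rightarrow> 'v) \<Rightarrow> ('v \<Rightarrow> 'v) \<Rightarrow>
   ('k \<Rightarrow> 'v::ab_group_add \<Rightarrow> 'v) \<Rightarrow> 'v set \<Rightarrow> ('v \<Rightarrow> 'a) \<Rightarrow> bool"
  where "O_operator s S dot circ P Q \<mu> l r \<alpha> \<beta> t W T \<longleftrightarrow>
    linear_on t W s S T \<and>
    (\<forall>u\<in>W. \<forall>v\<in>W. dot (T u) (T v) = T (\<mu> (T u) v + \<mu> (T v) u)) \<and>
    (\<forall>u\<in>W. \<forall>v\<in>W. circ (T u) (T v) = T (l (T u) v + r (T v) u)) \<and>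
    (\<forall>v\<in>W. P (T v) = T (\<alpha> v)) \<and>
    (\<forall>v\<in>W. Q (T v) = T (\<beta> v))"

text \<open>
  The tensor \<open>\<Sum>v\<in>B. v\<^sup>* \<otimes> T v\<close> for a basis \<open>B\<close> of \<open>V\<close>, as an element of the tensor square of
  \<open>A \<oplus> V\<^sup>*\<close>: \<open>v\<^sup>*\<close> is the coordinate functional of \<open>v\<close> with respect to \<open>B\<close>.
\<close>

definition map_tensor ::
  "('k::field \<Rightarrow> 'a::ab_group_add \<Rightarrow> 'a) \<Rightarrow> ('k \<Rightarrow> 'v::ab_group_add \<Rightarrow> 'v) \<Rightarrow> 'v set \<Rightarrow> ('v \<Rightarrow> 'a) \<Rightarrow>
   (('a \<times> ('v \<Rightarrow> 'k)) \<times> ('a \<times> ('v \<Rightarrow> 'k)) \<Rightarrow>\<^sub>0 'k) set"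
  where "map_tensor s t B T =
    coset (tensor2_null (module_prod.scale s dual_scale) (UNIV \<times> dual_space t))
      (\<Sum>v\<in>B. free_gen ((0, \<lambda>w. module.representation t B w v), (T v, 0)))"

end

theory Submission
  imports Defs
begin

text \<open>
  An element of the free space represents the zero tensor iff every multilinear form on the carrier
  kills it, so the Yang-Baxter equation for \<open>r = T - \<tau>(T)\<close> may be tested against arbitrary
  multilinear forms. Since \<open>\<Sum>v. T v \<otimes> v\<^sup>* \<circ> N = \<Sum>v. T (N v) \<otimes> v\<^sup>*\<close> for every endomorphism \<open>N\<close> of \<open>V\<close>,
  the actions on \<open>V\<^sup>*\<close> can be moved onto \<open>V\<close>, and \<open>\<^bold>A(r)\<close> and \<open>\<^bold>T(r)\<close> become sums over \<open>v, w\<close> of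
  the defects \<open>T v \<cdot> T w - T (\<mu> (T v) w + \<mu> (T w) v)\<close> and \<open>T v \<circ> T w - T (l (T v) w + r (T w) v)\<close>
  tensored with \<open>v\<^sup>* \<otimes> w\<^sup>*\<close> in the three possible positions. Forms concentrated on \<open>A \<otimes> V\<^sup>* \<otimes> V\<^sup>*\<close>
  isolate each defect. That the dual is a representation follows since every identity for \<open>V\<^sup>*\<close> is
  the transpose of a linear combination of the identities for \<open>V\<close>.
\<close>

section \<open>Multilinear forms and tensors\<close>

text \<open>A vector outside the span of \<open>G\<close> is separated from it by a functional that
  is 1 at that vector and 0 on \<open>G\<close>; it exists because values on an independent set
  extend linearly.\<close>

lemma (in vector_space) mem_span_iff_functionals:
  "p \<in> span G \<longleftrightarrow> (\<forall>f. Vector_Spaces.linear scale (*) f \<longrightarrow> (\<forall>g\<in>G. f g = 0) \<longrightarrow> f p = 0)"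
proof (intro iffI allI impI)
  fix f assume p: "p \<in> span G" and "Vector_Spaces.linear scale (*) f" and z: "\<forall>g\<in>G. f g = 0"
  then interpret f: Vector_Spaces.linear scale "(*)" f by simp
  show "f p = 0" using p z by (rule_tac f.eq_0_on_span[of G]) auto
next
  assume all: "\<forall>f. Vector_Spaces.linear scale (*) f \<longrightarrow> (\<forall>g\<in>G. f g = 0) \<longrightarrow> f p = 0"
  interpret k: vector_space "(*) :: 'a \<Rightarrow> 'a \<Rightarrow> 'a" by unfold_locales (simp_all add: algebra_simps)
  interpret pair: vector_space_pair scale "(*)" by unfold_locales
  show "p \<in> span G"
  proof (rule ccontr)
    assume p: "p \<notin> span G"
    \<comment> \<open>\<open>G\<close> itself may be dependent, so values are prescribed on a
      maximal independent subset with the same span, enlarged by \<open>p\<close>.\<close>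
    obtain B where B: "B \<subseteq> G" "independent B" "G \<subseteq> span B" by (rule maximal_independent_subset)
    then have pB: "p \<notin> span B" using p span_mono by blast
    obtain f where f: "Vector_Spaces.linear scale (*) f"
      and fB: "\<forall>x\<in>insert p B. f x = (if x = p then 1 else 0)"
      using pair.linear_independent_extend[OF independent_insertI[OF pB B(2)],
        of "\<lambda>x. if x = p then 1 else 0"] by blast
    interpret f: Vector_Spaces.linear scale "(*)" f by fact
    have "f g = 0" if "g \<in> G" for g
      by (rule f.eq_0_on_span[of B]) (use that B fB pB span_base in auto)
    then show False using all f fB by force
  qed
qed

section \<open>Functionals on the free vector space\<close>

lemma lookup_free_scale [simp]:
  "Poly_Mapping.lookup (free_scale c p) x = c * Poly_Mapping.lookup p x"
  by (cases "Poly_Mapping.lookup p x = 0") (simp_all add: free_scale_def Poly_Mapping.map.rep_eq)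

interpretation free: vector_space "free_scale :: 'k::field \<Rightarrow> ('x \<Rightarrow>\<^sub>0 'k) \<Rightarrow> ('x \<Rightarrow>\<^sub>0 'k)"
  by unfold_locales (auto intro!: poly_mapping_eqI simp: lookup_add algebra_simps)

definition lin_ext :: "('x \<Rightarrow> 'k) \<Rightarrow> ('x \<Rightarrow>\<^sub>0 'k) \<Rightarrow> 'k::field"
  where "lin_ext \<phi> p = (\<Sum>x\<in>Poly_Mapping.keys p. Poly_Mapping.lookup p x * \<phi> x)"

text \<open>Cancellation may shrink the support of a sum, so sums over different supports are
  compared on a common finite superset.\<close>

lemma lin_ext_superset:
  assumes "finite K" "Poly_Mapping.keys p \<subseteq> K"
  shows "lin_ext \<phi> p = (\<Sum>x\<in>K. Poly_Mapping.lookup p x * \<phi> x)"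
  unfolding lin_ext_def using assms by (intro sum.mono_neutral_left) (auto simp: in_keys_iff)

lemma lin_ext_cong: "(\<And>x. x \<in> Poly_Mapping.keys p \<Longrightarrow> \<phi> x = \<psi> x) \<Longrightarrow> lin_ext \<phi> p = lin_ext \<psi> p"
  by (simp add: lin_ext_def)

lemma lin_ext_add [simp]: "lin_ext \<phi> (p + q) = lin_ext \<phi> p + lin_ext \<phi> q"
proof -
  let ?K = "Poly_Mapping.keys p \<union> Poly_Mapping.keys q"
  have "lin_ext \<phi> (p + q) = (\<Sum>x\<in>?K. Poly_Mapping.lookup (p + q) x * \<phi> x)"
    by (intro lin_ext_superset keys_add) simp
  then show ?thesis
    by (simp add: lin_ext_superset[of ?K p] lin_ext_superset[of ?K q] lookup_add algebra_simps sum.distrib)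
qed

lemma lin_ext_scale [simp]: "lin_ext \<phi> (free_scale c p) = c * lin_ext \<phi> p"
  using lin_ext_superset[of "Poly_Mapping.keys p" "free_scale c p" \<phi>]
  by (simp add: lin_ext_def sum_distrib_left algebra_simps subset_iff in_keys_iff)

lemma lin_ext_gen [simp]: "lin_ext \<phi> (free_gen x) = \<phi> x"
  by (simp add: lin_ext_def)

lemma linear_ext: "Vector_Spaces.linear free_scale (*) (lin_ext \<phi>)"
  by unfold_locales (simp_all add: algebra_simps)

lemma lin_ext_diff [simp]: "lin_ext \<phi> (p - q) = lin_ext \<phi> p - lin_ext \<phi> q"
  by (rule module_hom.diff[OF linear_ext[folded module_hom_iff_linear]])

lemma lin_ext_sum [simp]: "lin_ext \<phi> (sum h I) = (\<Sum>i\<in>I. lin_ext \<phi> (h i))"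
  by (rule module_hom.sum[OF linear_ext[folded module_hom_iff_linear]])

lemma linear_eq_ext:
  assumes "Vector_Spaces.linear free_scale (*) f"
  shows "f p = lin_ext (\<lambda>x. f (free_gen x)) p"
proof -
  interpret f: Vector_Spaces.linear free_scale "(*)" f by fact
  have "p = (\<Sum>x\<in>Poly_Mapping.keys p. free_scale (Poly_Mapping.lookup p x) (free_gen x))"
    by (rule poly_mapping_eqI)
       (simp add: lookup_sum lookup_single when_def sum.delta in_keys_iff if_distrib cong: if_cong)
  then have "f p = f (\<Sum>x\<in>Poly_Mapping.keys p. free_scale (Poly_Mapping.lookup p x) (free_gen x))"
    by simp
  then show ?thesis by (simp add: lin_ext_def f.sum f.scale)
qed

section \<open>Null tensors as the common kernel of multilinear forms\<close>

definition bilinear_form ::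
  "('k \<Rightarrow> 'a \<Rightarrow> 'a) \<Rightarrow> 'a set \<Rightarrow> ('a::ab_group_add \<Rightarrow> 'a \<Rightarrow> 'k::field) \<Rightarrow> bool"
  where "bilinear_form s S \<phi> \<longleftrightarrow>
    (\<forall>y\<in>S. linear_on s S (*) UNIV (\<lambda>x. \<phi> x y)) \<and> (\<forall>x\<in>S. linear_on s S (*) UNIV (\<lambda>y. \<phi> x y))"

definition trilinear_form ::
  "('k \<Rightarrow> 'a \<Rightarrow> 'a) \<Rightarrow> 'a set \<Rightarrow> ('a::ab_group_add \<Rightarrow> 'a \<Rightarrow> 'a \<Rightarrow> 'k::field) \<Rightarrow> bool"
  where "trilinear_form s S \<phi> \<longleftrightarrow>
    (\<forall>y\<in>S. \<forall>z\<in>S. linear_on s S (*) UNIV (\<lambda>x. \<phi> x y z)) \<and>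
    (\<forall>x\<in>S. \<forall>z\<in>S. linear_on s S (*) UNIV (\<lambda>y. \<phi> x y z)) \<and>
    (\<forall>x\<in>S. \<forall>y\<in>S. linear_on s S (*) UNIV (\<lambda>z. \<phi> x y z))"

lemma ball_image3:
  "(\<forall>g\<in>{h x y z | x y z. R x y z}. Q g) \<longleftrightarrow> (\<forall>x y z. R x y z \<longrightarrow> Q (h x y z))"
  by blast

lemma ball_image4:
  "(\<forall>g\<in>{h x y z w | x y z w. R x y z w}. Q g) \<longleftrightarrow> (\<forall>x y z w. R x y z w \<longrightarrow> Q (h x y z w))"
  by blast

text \<open>A functional on the free space that kills the relators amounts to a bilinear form on the
  carrier, and the span of the relators is the common kernel of these functionals.\<close>

lemma tensor2_null_iff:
  "p \<in> tensor2_null s S \<longleftrightarrow>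
    (\<forall>\<phi>. bilinear_form s S \<phi> \<longrightarrow> lin_ext (\<lambda>(x, y). \<phi> x y) p = 0)" (is "_ \<longleftrightarrow> ?R")
proof
  assume p: "p \<in> tensor2_null s S"
  show ?R
  proof (intro allI impI)
    fix \<phi> assume "bilinear_form s S \<phi>"
    then show "lin_ext (\<lambda>(x, y). \<phi> x y) p = 0"
      using p unfolding tensor2_null_def
      by (elim free.mem_span_iff_functionals[THEN iffD1, rule_format, OF _ linear_ext])
         (auto simp: bilinear_form_def linear_on_def)
  qed
next
  assume R: ?R
  show "p \<in> tensor2_null s S"
    unfolding tensor2_null_def free.mem_span_iff_functionals
  proof (intro allI impI, goal_cases)
    case (1 f)
    interpret f: Vector_Spaces.linear free_scale "(*)" f by (rule 1)
    \<comment> \<open>Read on generators, the vanishing of \<open>f\<close> on each of the four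
      families of relators is additivity or homogeneity in one argument.\<close>
    have "bilinear_form s S (\<lambda>x y. f (free_gen (x, y)))"
      using 1(2) unfolding bilinear_form_def linear_on_def ball_Un ball_image3 f.diff f.scale
      by (simp add: diff_diff_eq)
    then have "lin_ext (\<lambda>(x, y). f (free_gen (x, y))) p = 0" using R by blast
    then show ?case using linear_eq_ext[OF 1(1), of p] by (simp add: case_prod_unfold)
  qed
qed

lemma tensor3_null_iff:
  "p \<in> tensor3_null s S \<longleftrightarrow>
    (\<forall>\<phi>. trilinear_form s S \<phi> \<longrightarrow> lin_ext (\<lambda>(x, y, z). \<phi> x y z) p = 0)" (is "_ \<longleftrightarrow> ?R")
proof
  assume p: "p \<in> tensor3_null s S"
  show ?R
  proof (intro allI impI)
    fix \<phi> assume "trilinear_form s S \<phi>"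
    then show "lin_ext (\<lambda>(x, y, z). \<phi> x y z) p = 0"
      using p unfolding tensor3_null_def
      by (elim free.mem_span_iff_functionals[THEN iffD1, rule_format, OF _ linear_ext])
         (auto simp: trilinear_form_def linear_on_def)
  qed
next
  assume R: ?R
  show "p \<in> tensor3_null s S"
    unfolding tensor3_null_def free.mem_span_iff_functionals
  proof (intro allI impI, goal_cases)
    case (1 f)
    interpret f: Vector_Spaces.linear free_scale "(*)" f by (rule 1)
    have "trilinear_form s S (\<lambda>x y z. f (free_gen (x, y, z)))"
      using 1(2) unfolding trilinear_form_def linear_on_def ball_Un ball_image4 f.diff f.scale
      by (simp add: diff_diff_eq)
    then have "lin_ext (\<lambda>(x, y, z). f (free_gen (x, y, z))) p = 0" using R by blast
    then show ?case using linear_eq_ext[OF 1(1), of p] by (simp add: case_prod_unfold)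
  qed
qed

section \<open>Cosets and the Yang-Baxter maps\<close>

lemma coset_eq_iff:
  fixes N :: "('x \<Rightarrow>\<^sub>0 'k::field) set"
  assumes "module.subspace free_scale N"
  shows "coset N p = coset N q \<longleftrightarrow> p - q \<in> N"
proof
  assume "coset N p = coset N q"
  then have "p + 0 \<in> coset N q"
    using free.subspace_0[OF assms] unfolding coset_def by blast
  then show "p - q \<in> N" by (auto simp: coset_def)
next
  assume pq: "p - q \<in> N"
  have "coset N a \<subseteq> coset N b" if "a - b \<in> N" for a b
  proof
    fix x assume "x \<in> coset N a"
    then obtain n where "n \<in> N" "x = b + ((a - b) + n)" by (auto simp: coset_def)
    then show "x \<in> coset N b"
      using free.subspace_add[OF assms that] unfolding coset_def by blast
  qed
  moreover have "q - p \<in> N" using free.subspace_neg[OF assms pq] by simp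
  ultimately show "coset N p = coset N q" using pq by blast
qed

lemma coset_eq_self_iff:
  fixes N :: "('x \<Rightarrow>\<^sub>0 'k::field) set"
  assumes "module.subspace free_scale N"
  shows "coset N p = N \<longleftrightarrow> p \<in> N"
  using coset_eq_iff[OF assms, of p 0] by (simp add: coset_def)

lemma coset_diff_coset:
  fixes N :: "('x \<Rightarrow>\<^sub>0 'k::field) set"
  assumes "module.subspace free_scale N"
  shows "coset_diff (coset N p) (coset N q) = coset N (p - q)"
proof (intro subset_antisym subsetI)
  fix x assume "x \<in> coset_diff (coset N p) (coset N q)"
  then obtain m n where "m \<in> N" "n \<in> N" "x = p - q + (m - n)"
    by (auto simp: coset_def coset_diff_def algebra_simps)
  then show "x \<in> coset N (p - q)"
    using free.subspace_diff[OF assms] unfolding coset_def by blast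
next
  fix x assume "x \<in> coset N (p - q)"
  then obtain m where "m \<in> N" "x = (p + m) - (q + 0)"
    by (auto simp: coset_def)
  then show "x \<in> coset_diff (coset N p) (coset N q)"
    using free.subspace_0[OF assms] unfolding coset_def coset_diff_def by blast
qed

text \<open>\<open>the_elem\<close> is meaningful only on a singleton; shifting the representative
  by an element of \<open>M\<close> changes \<open>F\<close> only inside \<open>N\<close>, so all
  representatives yield one coset.\<close>

lemma induced_coset:
  fixes M :: "('x \<Rightarrow>\<^sub>0 'k::field) set" and N :: "('y \<Rightarrow>\<^sub>0 'k) set"
  assumes "module.subspace free_scale M" "module.subspace free_scale N"
    and "\<And>n. n \<in> M \<Longrightarrow> F (p + n) - F p \<in> N"
  shows "induced N F (coset M p) = coset N (F p)"
proof -
  have "coset N (F q) = coset N (F p)" if "q \<in> coset M p" for q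
  proof -
    from that obtain n where "n \<in> M" "q = p + n" unfolding coset_def by blast
    then show ?thesis using assms(3) by (simp add: coset_eq_iff[OF assms(2)])
  qed
  moreover have "p + 0 \<in> coset M p"
    using free.subspace_0[OF assms(1)] unfolding coset_def by blast
  ultimately have "(\<lambda>q. coset N (F q)) ` coset M p = {coset N (F p)}" by blast
  then show ?thesis by (simp add: induced_def)
qed

lemma subspace_tensor2_null [simp]: "module.subspace free_scale (tensor2_null s S)"
  by (simp add: tensor2_null_def)

lemma subspace_tensor3_null [simp]: "module.subspace free_scale (tensor3_null s S)"
  by (simp add: tensor3_null_def)

section \<open>Maps of the tensor square induced from generators\<close>

definition push :: "('x \<Rightarrow> 'y) \<Rightarrow> ('x \<Rightarrow>\<^sub>0 'k) \<Rightarrow> ('y \<Rightarrow>\<^sub>0 'k::field)"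
  where "push g p = (\<Sum>x\<in>Poly_Mapping.keys p. free_scale (Poly_Mapping.lookup p x) (free_gen (g x)))"

lemma lin_ext_push [simp]: "lin_ext \<phi> (push g p) = lin_ext (\<lambda>x. \<phi> (g x)) p"
  by (simp add: push_def lin_ext_def[of _ p])

text \<open>Pulling a bilinear form back along \<open>g\<close> gives a bilinear form again, so
  \<open>push g\<close> sends null tensors to null tensors.\<close>

lemma push_induced:
  assumes "\<And>\<phi>. bilinear_form s S \<phi> \<Longrightarrow> bilinear_form s S (\<lambda>a b. case g (a, b) of (x, y) \<Rightarrow> \<phi> x y)"
  shows "induced (tensor2_null s S) (push g) (coset (tensor2_null s S) p)
    = coset (tensor2_null s S) (push g p)"
proof (rule induced_coset)
  fix n assume n: "n \<in> tensor2_null s S"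
  have "lin_ext (\<lambda>(a, b). case g (a, b) of (x, y) \<Rightarrow> \<phi> x y) n = 0" if "bilinear_form s S \<phi>" for \<phi>
    using n assms[OF that] unfolding tensor2_null_iff by blast
  then show "push g (p + n) - push g p \<in> tensor2_null s S"
    by (simp add: tensor2_null_iff case_prod_unfold)
qed simp_all

lemma tensor2_map_coset:
  assumes "linear_on s S s S f" "linear_on s S s S g"
  shows "tensor2_map s S f g (coset (tensor2_null s S) p)
    = coset (tensor2_null s S) (push (\<lambda>(a, b). (f a, g b)) p)"
proof -
  have "tensor2_map s S f g = induced (tensor2_null s S) (push (\<lambda>(a, b). (f a, g b)))"
    unfolding tensor2_map_def push_def by (simp add: case_prod_unfold)
  moreover have "bilinear_form s S (\<lambda>a b. \<phi> (f a) (g b))" if "bilinear_form s S \<phi>" for \<phi>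
    using that assms by (auto simp: bilinear_form_def linear_on_def)
  ultimately show ?thesis by (simp add: push_induced)
qed

lemma tensor2_flip_coset:
  "tensor2_flip s S (coset (tensor2_null s S) p)
    = coset (tensor2_null s S) (push (\<lambda>(a, b). (b, a)) p)"
proof -
  have "tensor2_flip s S = induced (tensor2_null s S) (push (\<lambda>(a, b). (b, a)))"
    unfolding tensor2_flip_def push_def by (simp add: case_prod_unfold)
  moreover have "bilinear_form s S (\<lambda>a b. \<phi> b a)" if "bilinear_form s S \<phi>" for \<phi>
    using that by (auto simp: bilinear_form_def)
  ultimately show ?thesis by (simp add: push_induced)
qed

lemma tensor2_map_diff_eq_null_iff:
  assumes "linear_on s S s S f" "linear_on s S s S g" "linear_on s S s S f'" "linear_on s S s S g'"
  shows "coset_diff (tensor2_map s S f g (coset (tensor2_null s S) p))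
      (tensor2_map s S f' g' (coset (tensor2_null s S) p)) = tensor2_null s S \<longleftrightarrow>
    (\<forall>\<phi>. bilinear_form s S \<phi> \<longrightarrow> lin_ext (\<lambda>(a, b). \<phi> (f a) (g b)) p = lin_ext (\<lambda>(a, b). \<phi> (f' a) (g' b)) p)"
  unfolding tensor2_map_coset[OF assms(1,2)] tensor2_map_coset[OF assms(3,4)]
    coset_diff_coset[OF subspace_tensor2_null] coset_eq_self_iff[OF subspace_tensor2_null]
    tensor2_null_iff
  by (simp add: case_prod_unfold)

text \<open>The relators are supported on pairs from \<open>S\<close> because \<open>S\<close> is
  closed under sums and multiples. This keeps \<open>p + n\<close> supported on the carrier, where
  the forms are known to be linear.\<close>

lemma keys_tensor2_null:
  assumes "module s" "module.subspace s S" "n \<in> tensor2_null s S"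
  shows "Poly_Mapping.keys n \<subseteq> S \<times> S"
proof -
  interpret module s by fact
  have K: "Poly_Mapping.keys (p - q) \<subseteq> K" "Poly_Mapping.keys (p + q) \<subseteq> K"
    if "Poly_Mapping.keys p \<subseteq> K" "Poly_Mapping.keys q \<subseteq> K" for p q :: "'b \<times> 'b \<Rightarrow>\<^sub>0 'a" and K
    using that keys_diff[of p q] keys_add[of p q] by auto
  have scl: "Poly_Mapping.keys (free_scale c p) \<subseteq> K"
    if "Poly_Mapping.keys p \<subseteq> K" for c and p :: "'b \<times> 'b \<Rightarrow>\<^sub>0 'a" and K
    using that by (auto simp: in_keys_iff)
  have "tensor2_null s S \<subseteq> {n. Poly_Mapping.keys n \<subseteq> S \<times> S}"
    unfolding tensor2_null_def
  proof (rule free.span_minimal)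
    show "free.subspace {n::'b \<times> 'b \<Rightarrow>\<^sub>0 'a. Poly_Mapping.keys n \<subseteq> S \<times> S}"
      by (rule free.subspaceI) (simp_all add: K scl)
  qed (auto simp: in_keys_iff lookup_minus lookup_single when_def assms(2) subspace_add subspace_scale
      split: if_splits)
  then show ?thesis using assms(3) by blast
qed

section \<open>Quadratic maps from the tensor square to the tensor cube\<close>

definition quadrilinear_form ::
  "('k \<Rightarrow> 'a \<Rightarrow> 'a) \<Rightarrow> 'a set \<Rightarrow> ('a::ab_group_add \<Rightarrow> 'a \<Rightarrow> 'a \<Rightarrow> 'a \<Rightarrow> 'k::field) \<Rightarrow> bool"
  where "quadrilinear_form s S \<Psi> \<longleftrightarrow>
    (\<forall>a'\<in>S. \<forall>b'\<in>S. bilinear_form s S (\<lambda>a b. \<Psi> a b a' b')) \<and>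
    (\<forall>a\<in>S. \<forall>b\<in>S. bilinear_form s S (\<Psi> a b))"

text \<open>The form \<open>\<Psi>\<close> evaluated on the tensor product of \<open>p\<close> and
  \<open>q\<close>; a quadratic expression in a tensor is this value on the diagonal.\<close>

definition lin_ext2 :: "('a \<Rightarrow> 'a \<Rightarrow> 'a \<Rightarrow> 'a \<Rightarrow> 'k) \<Rightarrow> ('a \<times> 'a \<Rightarrow>\<^sub>0 'k) \<Rightarrow> ('a \<times> 'a \<Rightarrow>\<^sub>0 'k) \<Rightarrow> 'k::field"
  where "lin_ext2 \<Psi> p q = lin_ext (\<lambda>(a, b). lin_ext (\<lambda>(a', b'). \<Psi> a b a' b') q) p"

lemma bilinear_form_sum:
  assumes "\<And>i. i \<in> I \<Longrightarrow> bilinear_form s S (\<phi> i)"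
  shows "bilinear_form s S (\<lambda>a b. \<Sum>i\<in>I. c i * \<phi> i a b)"
  using assms
  by (simp add: bilinear_form_def linear_on_def sum.distrib sum_distrib_left distrib_left
      mult_ac)

text \<open>The two arguments are changed from \<open>p + n\<close> to \<open>p\<close> one after
  the other; bilinearity in the corresponding pair of slots makes each change invisible.\<close>

lemma lin_ext2_add_null:
  assumes "quadrilinear_form s S \<Psi>" "module s" "module.subspace s S"
    and p: "Poly_Mapping.keys p \<subseteq> S \<times> S" and n: "n \<in> tensor2_null s S"
  shows "lin_ext2 \<Psi> (p + n) (p + n) = lin_ext2 \<Psi> p p"
proof -
  have "Poly_Mapping.keys n \<subseteq> S \<times> S" using assms(2,3) n by (rule keys_tensor2_null)
  then have pn: "Poly_Mapping.keys (p + n) \<subseteq> S \<times> S" using p keys_add[of p n] by blast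
  \<comment> \<open>With the second tensor fixed, the value is a finite linear combination of
    bilinear forms in \<open>a\<close> and \<open>b\<close>, so it kills the null tensor
    \<open>n\<close>.\<close>
  have "bilinear_form s S (\<lambda>a b. \<Sum>x\<in>Poly_Mapping.keys (p + n).
      Poly_Mapping.lookup (p + n) x * \<Psi> a b (fst x) (snd x))"
    using assms(1) pn by (intro bilinear_form_sum) (auto simp: quadrilinear_form_def)
  then have "bilinear_form s S (\<lambda>a b. lin_ext (\<lambda>(a', b'). \<Psi> a b a' b') (p + n))"
    by (simp add: lin_ext_def case_prod_unfold)
  then have 1: "lin_ext2 \<Psi> n (p + n) = 0"
    using n unfolding lin_ext2_def tensor2_null_iff by blast
  \<comment> \<open>Now \<open>a\<close> and \<open>b\<close> are frozen; they will range over the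
    support of \<open>p\<close>, hence over the carrier, where \<open>\<Psi> a b\<close> is
    bilinear.\<close>
  have "lin_ext (\<lambda>(a', b'). \<Psi> a b a' b') n = 0" if "a \<in> S" "b \<in> S" for a b
    using n assms(1) that unfolding tensor2_null_iff quadrilinear_form_def by blast
  then have "lin_ext2 \<Psi> p (p + n) = lin_ext2 \<Psi> p p"
    unfolding lin_ext2_def using p by (intro lin_ext_cong) auto
  with 1 show ?thesis unfolding lin_ext2_def by simp
qed

text \<open>Both Yang-Baxter expressions have this shape: \<open>H\<close> is the combination of
  generators of the tensor cube attached to a pair of summands of \<open>r\<close>. Quadrilinearity
  of \<open>H\<close> under every test form gives independence of the representative.\<close>

lemma quadratic_induced:
  fixes H :: "'a::ab_group_add \<Rightarrow> 'a \<Rightarrow> 'a \<Rightarrow> 'a \<Rightarrow> ('a \<times> 'a \<times> 'a \<Rightarrow>\<^sub>0 'k::field)"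
  assumes "module s" "module.subspace s S" and p: "Poly_Mapping.keys p \<subseteq> S \<times> S"
    and "\<And>\<phi>. trilinear_form s S \<phi> \<Longrightarrow>
      quadrilinear_form s S (\<lambda>a b a' b'. lin_ext (\<lambda>(x, y, z). \<phi> x y z) (H a b a' b'))"
  defines "F \<equiv> \<lambda>p. \<Sum>(a, b)\<in>Poly_Mapping.keys p. \<Sum>(a', b')\<in>Poly_Mapping.keys p.
      free_scale (Poly_Mapping.lookup p (a, b) * Poly_Mapping.lookup p (a', b')) (H a b a' b')"
  shows "induced (tensor3_null s S) F (coset (tensor2_null s S) p) = tensor3_null s S \<longleftrightarrow>
    (\<forall>\<phi>. trilinear_form s S \<phi> \<longrightarrow>
      lin_ext2 (\<lambda>a b a' b'. lin_ext (\<lambda>(x, y, z). \<phi> x y z) (H a b a' b')) p p = 0)"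
proof -
  have F: "lin_ext \<theta> (F q) = lin_ext2 (\<lambda>a b a' b'. lin_ext \<theta> (H a b a' b')) q q" for \<theta> q
    unfolding F_def lin_ext2_def lin_ext_def[of _ q] case_prod_unfold prod.collapse lin_ext_sum lin_ext_scale
      sum_distrib_left mult.assoc ..
  have "F (p + n) - F p \<in> tensor3_null s S" if "n \<in> tensor2_null s S" for n
    unfolding tensor3_null_iff
    using lin_ext2_add_null[OF assms(4,1,2) p that] by (simp add: F)
  then have "induced (tensor3_null s S) F (coset (tensor2_null s S) p) = coset (tensor3_null s S) (F p)"
    by (intro induced_coset) simp_all
  then show ?thesis by (simp add: coset_eq_self_iff tensor3_null_iff F)
qed

lemma trilinear_formD:
  assumes "trilinear_form s S \<phi>" "x \<in> S" "y \<in> S" "z \<in> S"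
  shows "x' \<in> S \<Longrightarrow> \<phi> (x + x') y z = \<phi> x y z + \<phi> x' y z"
    "y' \<in> S \<Longrightarrow> \<phi> x (y + y') z = \<phi> x y z + \<phi> x y' z"
    "z' \<in> S \<Longrightarrow> \<phi> x y (z + z') = \<phi> x y z + \<phi> x y z'"
    "\<phi> (s c x) y z = c * \<phi> x y z"
    "\<phi> x (s c y) z = c * \<phi> x y z"
    "\<phi> x y (s c z) = c * \<phi> x y z"
  using assms unfolding trilinear_form_def linear_on_def by blast+

lemma bilinear_onD:
  assumes "bilinear_on s S t W f" "x \<in> S" "u \<in> W"
  shows "f x u \<in> W"
    "x' \<in> S \<Longrightarrow> f (x + x') u = f x u + f x' u"
    "u' \<in> W \<Longrightarrow> f x (u + u') = f x u + f x u'"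
    "f (s c x) u = t c (f x u)"
    "f x (t c u) = t c (f x u)"
  using assms unfolding bilinear_on_def linear_on_def by blast+

lemma YB_A_eq_null_iff:
  assumes "module s" "module.subspace s S" "Poly_Mapping.keys p \<subseteq> S \<times> S"
    and dot: "bilinear_on s S s S dot"
  shows "YB_A s S dot (coset (tensor2_null s S) p) = tensor3_null s S \<longleftrightarrow>
    (\<forall>\<phi>. trilinear_form s S \<phi> \<longrightarrow>
      lin_ext2 (\<lambda>a b a' b'. \<phi> (dot a a') b b' - \<phi> a (dot a' b) b' + \<phi> a a' (dot b b')) p p = 0)"
proof -
  have "quadrilinear_form s S (\<lambda>a b a' b'.
      \<phi> (dot a a') b b' - \<phi> a (dot a' b) b' + \<phi> a a' (dot b b'))"
    if "trilinear_form s S \<phi>" for \<phi>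
    by (simp add: quadrilinear_form_def bilinear_form_def linear_on_def
        trilinear_formD[OF that] bilinear_onD[OF dot] ring_distribs)
  then show ?thesis
    unfolding YB_A_def using assms(1-3) by (subst quadratic_induced) simp_all
qed

lemma YB_T_eq_null_iff:
  assumes "module s" "module.subspace s S" "Poly_Mapping.keys p \<subseteq> S \<times> S"
    and circ: "bilinear_on s S s S circ" and bracket: "bilinear_on s S s S (sub_adjacent circ)"
  shows "YB_T s S circ (coset (tensor2_null s S) p) = tensor3_null s S \<longleftrightarrow>
    (\<forall>\<phi>. trilinear_form s S \<phi> \<longrightarrow>
      lin_ext2 (\<lambda>a b a' b'. \<phi> (circ a a') b b' + \<phi> a (circ b a') b'
        - \<phi> a a' (sub_adjacent circ b b')) p p = 0)"
proof -
  have "quadrilinear_form s S (\<lambda>a b a' b'.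
      \<phi> (circ a a') b b' + \<phi> a (circ b a') b' - \<phi> a a' (sub_adjacent circ b b'))"
    if "trilinear_form s S \<phi>" for \<phi>
    by (simp add: quadrilinear_form_def bilinear_form_def linear_on_def
        trilinear_formD[OF that] bilinear_onD[OF circ] bilinear_onD[OF bracket] ring_distribs)
  then show ?thesis
    unfolding YB_T_def using assms(1-3) by (subst quadratic_induced) simp_all
qed

section \<open>The dual representation\<close>

lemma linear_onD:
  fixes f :: "'a::ab_group_add \<Rightarrow> 'b::ab_group_add"
  assumes "linear_on s UNIV t UNIV f"
  shows "f (x + y) = f x + f y" "f (s c x) = t c (f x)" "f 0 = 0" "f (- x) = - f x" "f (x - y) = f x - f y"
proof -
  show add: "f (x + y) = f x + f y" for x y using assms by (simp add: linear_on_def)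
  show "f (s c x) = t c (f x)" using assms by (simp add: linear_on_def)
  show 0: "f 0 = 0" using add[of 0 0] by simp
  show neg: "f (- x) = - f x" for x using add[of x "- x"] 0 by (simp add: minus_unique)
  show "f (x - y) = f x - f y" using add[of x "- y"] neg by simp
qed

lemma bilinear_on_UNIVD:
  fixes f :: "'a::ab_group_add \<Rightarrow> 'b::ab_group_add \<Rightarrow> 'b"
  assumes "bilinear_on s UNIV t UNIV f"
  shows "f (x + y) u = f x u + f y u" "f (s c x) u = t c (f x u)" "f 0 u = 0"
    "f (- x) u = - f x u" "f (x - y) u = f x u - f y u"
    "f x (u + v) = f x u + f x v" "f x (t c u) = t c (f x u)" "f x 0 = 0"
    "f x (- u) = - f x u" "f x (u - v) = f x u - f x v"
  using assms linear_onD[of s t "\<lambda>x. f x u"] linear_onD[of t t "f x"]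
  by (simp_all add: bilinear_on_def)

text \<open>The Jacobi identity holds because the cyclic sum of double brackets expands into left
  sides of the two anti-pre-Lie identities.\<close>

lemma (in anti_pre_Lie_algebra) lie_algebra_sub_adjacent:
  "lie_algebra_on scale S (sub_adjacent (\<odot>))"
proof unfold_locales
  note bl = bilinear_onD[OF circ_bilinear]
  have diff: "x \<odot> (y - z) = x \<odot> y - x \<odot> z" if "x \<in> S" "y \<in> S" "z \<in> S" for x y z
    using bl(3)[OF that(1) subspace_diff[OF subspace_carrier that(2,3)] that(3)] by simp
  have in_S: "sub_adjacent (\<odot>) x y \<in> S" if "x \<in> S" "y \<in> S" for x y
    using that by (simp add: sub_adjacent_def bl subspace_diff[OF subspace_carrier])
  show "bilinear_on scale S scale S (sub_adjacent (\<odot>))"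
    by (simp add: bilinear_on_def linear_on_def in_S)
       (simp add: sub_adjacent_def bl scale_right_diff_distrib)
  fix x y z assume xyz: "x \<in> S" "y \<in> S" "z \<in> S"
  let ?b = "sub_adjacent (\<odot>)"
  have b: "?b x (?b y z) = x \<odot> (y \<odot> z) - x \<odot> (z \<odot> y) - ?b y z \<odot> x"
    if "x \<in> S" "y \<in> S" "z \<in> S" for x y z
    using that by (simp add: sub_adjacent_def diff bl)
  \<comment> \<open>After regrouping, each parenthesized difference is an instance of the first
    identity, and the subtracted cyclic sum is the second.\<close>
  have "?b x (?b y z) + ?b y (?b z x) + ?b z (?b x y)
    = (x \<odot> (y \<odot> z) - y \<odot> (x \<odot> z)) + (y \<odot> (z \<odot> x) - z \<odot> (y \<odot> x))
      + (z \<odot> (x \<odot> y) - x \<odot> (z \<odot> y)) - (?b x y \<odot> z + ?b y z \<odot> x + ?b z x \<odot> y)"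
    using xyz by (simp add: b)
  also have "\<dots> = ?b y x \<odot> z + ?b z y \<odot> x + ?b x z \<odot> y"
    using xyz by (simp add: anti_pre_Lie_1 anti_pre_Lie_2)
  \<comment> \<open>The remaining sum is the second identity with \<open>x\<close> and
    \<open>y\<close> exchanged.\<close>
  also have "\<dots> = 0"
    using anti_pre_Lie_2[of y x z] xyz by (simp add: add_ac)
  finally show "?b x (?b y z) + ?b y (?b z x) + ?b z (?b x y) = 0" .
qed (simp add: sub_adjacent_def)

interpretation dual: vector_space "dual_scale :: 'k::field \<Rightarrow> ('v \<Rightarrow> 'k) \<Rightarrow> 'v \<Rightarrow> 'k"
  by unfold_locales (auto simp: dual_scale_def algebra_simps)

lemma dual_spaceD:
  assumes "f \<in> dual_space t"
  shows "f (u + v) = f u + f v" "f (t c u) = c * f u" "f 0 = 0" "f (- u) = - f u" "f (u - v) = f u - f v"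
proof -
  interpret f: Vector_Spaces.linear t "(*)" f using assms by (simp add: dual_space_def)
  show "f (u + v) = f u + f v" "f (t c u) = c * f u" "f 0 = 0" "f (- u) = - f u" "f (u - v) = f u - f v"
    by (simp_all add: f.add f.scale f.neg f.diff)
qed

lemma (in vector_space) dual_space_iff:
  "f \<in> dual_space scale \<longleftrightarrow> (\<forall>u v. f (u + v) = f u + f v) \<and> (\<forall>c u. f (c *s u) = c * f u)"
proof -
  have "Vector_Spaces.linear scale (*) f" if "\<forall>u v. f (u + v) = f u + f v" "\<forall>c u. f (c *s u) = c * f u"
    using that by unfold_locales (simp_all add: algebra_simps)
  then show ?thesis by (auto simp: dual_spaceD) (simp add: dual_space_def)
qed

lemma (in vector_space) subspace_dual_space: "module.subspace dual_scale (dual_space scale)"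
  by (rule dual.subspaceI) (auto simp: dual_space_iff dual_scale_def algebra_simps)

lemma sum_fun_apply: "(\<Sum>i\<in>I. F i) v = (\<Sum>i\<in>I. F i v)"
  for F :: "'i \<Rightarrow> 'c \<Rightarrow> 'd::comm_monoid_add"
  by (induction I rule: infinite_finite_induct) simp_all

locale relative_PCA_rep = relative_PCA_algebra sA UNIV dot circ P Q +
  V: finite_dimensional_vector_space sV B
  for sA :: "'k::{field_char_0, alg_closed_field} \<Rightarrow> 'a::ab_group_add \<Rightarrow> 'a"
    and sV :: "'k \<Rightarrow> 'v::ab_group_add \<Rightarrow> 'v"
    and dot :: "'a \<Rightarrow> 'a \<Rightarrow> 'a" (infixl "\<cdot>" 70) and circ :: "'a \<Rightarrow> 'a \<Rightarrow> 'a" (infixl "\<odot>" 70)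
    and P Q :: "'a \<Rightarrow> 'a" and B :: "'v set" +
  fixes \<mu> l r :: "'a \<Rightarrow> 'v \<Rightarrow> 'v" and \<alpha> \<beta> :: "'v \<Rightarrow> 'v"
  assumes rep: "relative_PCA_representation sA UNIV dot circ P Q \<mu> l r \<alpha> \<beta> sV UNIV"
begin

section \<open>Operator identities of a representation\<close>

interpretation SD: relative_PCA_algebra "module_prod.scale sA sV" "UNIV \<times> UNIV"
  "semidirect_mult dot \<mu>" "semidirect_circ circ l r" "map_prod P \<alpha>" "map_prod Q \<beta>"
  using rep by (simp add: relative_PCA_representation_def)

abbreviation "hscale \<equiv> module_prod.scale sA (dual_scale :: 'k \<Rightarrow> ('v \<Rightarrow> 'k) \<Rightarrow> 'v \<Rightarrow> 'k)"
abbreviation "hS \<equiv> UNIV \<times> dual_space sV"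
abbreviation "hdot \<equiv> semidirect_mult dot (- dual_rep \<mu> :: 'a \<Rightarrow> ('v \<Rightarrow> 'k) \<Rightarrow> 'v \<Rightarrow> 'k)"
abbreviation "hcirc \<equiv> semidirect_circ circ (dual_rep r - dual_rep l :: 'a \<Rightarrow> ('v \<Rightarrow> 'k) \<Rightarrow> 'v \<Rightarrow> 'k) (dual_rep r)"
abbreviation "hP \<equiv> map_prod P (transpose_map \<beta> :: ('v \<Rightarrow> 'k) \<Rightarrow> 'v \<Rightarrow> 'k)"
abbreviation "hQ \<equiv> map_prod Q (transpose_map \<alpha> :: ('v \<Rightarrow> 'k) \<Rightarrow> 'v \<Rightarrow> 'k)"

lemma rep_bilinear:
  shows mu: "bilinear_on sA UNIV sV UNIV \<mu>" and l: "bilinear_on sA UNIV sV UNIV l"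
    and r: "bilinear_on sA UNIV sV UNIV r"
    and alpha: "linear_on sV UNIV sV UNIV \<alpha>" and beta: "linear_on sV UNIV sV UNIV \<beta>"
  using rep by (simp_all add: relative_PCA_representation_def)

lemmas lin_simps = bilinear_on_UNIVD[OF mult_bilinear] bilinear_on_UNIVD[OF circ_bilinear]
  bilinear_on_UNIVD[OF mu] bilinear_on_UNIVD[OF l] bilinear_on_UNIVD[OF r]
  linear_onD[OF alpha] linear_onD[OF beta] linear_onD[OF P_linear] linear_onD[OF Q_linear]

lemmas semidirect_simps = semidirect_mult_def semidirect_circ_def sub_adjacent_def zero_prod_def lin_simps

text \<open>Axioms of the semi-direct product with \<open>V\<close> are evaluated with one argument
  in \<open>V\<close> and the others in \<open>A\<close>; the component in \<open>V\<close> is an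
  identity of operators. Here this is associativity; commutativity of \<open>A\<close> then
  exchanges the factors.\<close>

lemma rep_mult: "\<mu> (x \<cdot> y) v = \<mu> x (\<mu> y v)" "\<mu> x (\<mu> y v) = \<mu> y (\<mu> x v)"
proof -
  show m: "\<mu> (x \<cdot> y) v = \<mu> x (\<mu> y v)" for x y
    using SD.mult_assoc[of "(x, 0)" "(y, 0)" "(0, v)"] by (simp add: semidirect_simps)
  show "\<mu> x (\<mu> y v) = \<mu> y (\<mu> x v)"
    unfolding m[symmetric] by (simp add: mult_comm)
qed

text \<open>The first anti-pre-Lie identity is antisymmetric in its first two arguments and the
  second is cyclic, so these placements of \<open>v\<close> exhaust both.\<close>

lemma rep_circ:
  "l x (l y v) - l y (l x v) = l (y \<odot> x) v - l (x \<odot> y) v"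
  "l x (r z v) - r (x \<odot> z) v = r z (r x v) - r z (l x v)"
  "l (x \<odot> y) v - l (y \<odot> x) v + (r x (l y v) - r x (r y v)) + (r y (r x v) - r y (l x v)) = 0"
  using SD.anti_pre_Lie_1[of "(x, 0)" "(y, 0)" "(0, v)"] SD.anti_pre_Lie_1[of "(x, 0)" "(0, v)" "(z, 0)"]
    SD.anti_pre_Lie_2[of "(x, 0)" "(y, 0)" "(0, v)"]
  by (simp_all add: semidirect_simps algebra_simps)

lemma rep_P:
  "\<alpha> (\<mu> x v) = \<mu> (P x) v + \<mu> x (\<alpha> v)"
  "\<alpha> (l x v) - \<alpha> (r x v) = l (P x) v - r (P x) v + l x (\<alpha> v) - r x (\<alpha> v)"
  using SD.P_derivation_mult[of "(x, 0)" "(0, v)"] SD.P_derivation_bracket[of "(x, 0)" "(0, v)"]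
  by (simp_all add: semidirect_simps algebra_simps)

lemma rep_Leibniz:
  "r (x \<cdot> y) v - l (x \<cdot> y) v = \<mu> y (r x v) - \<mu> y (l x v) + (\<mu> x (r y v) - \<mu> x (l y v)) + \<mu> x (\<mu> y (\<alpha> v))"
  "l z (\<mu> x v) - r z (\<mu> x v) = \<mu> (z \<odot> x) v - \<mu> (x \<odot> z) v + (\<mu> x (l z v) - \<mu> x (r z v)) + \<mu> x (\<mu> (P z) v)"
  using SD.relative_Leibniz[of "(x, 0)" "(y, 0)" "(0, v)"] SD.relative_Leibniz[of "(x, 0)" "(0, v)" "(z, 0)"]
  by (simp_all add: semidirect_simps rep_mult algebra_simps)

lemma rep_PQ:
  "\<mu> x (\<beta> v) = \<mu> (P x) v + \<beta> (\<mu> x v)"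
  "\<mu> (Q x) v = \<mu> x (\<alpha> v) + \<beta> (\<mu> x v)"
  "l x (\<beta> v) = l (P x) v + \<beta> (l x v)"
  "r (Q x) v = r x (\<alpha> v) + \<beta> (r x v)"
  using SD.PQ_mult[of "(x, 0)" "(0, v)"] SD.PQ_mult[of "(0, v)" "(x, 0)"]
    SD.PQ_circ[of "(x, 0)" "(0, v)"] SD.PQ_circ[of "(0, v)" "(x, 0)"]
  by (simp_all add: semidirect_simps algebra_simps)

text \<open>The first condition is used with \<open>v\<close> in each of its three places; the
  second is symmetric in its first two arguments, so two places suffice.\<close>

lemma rep_PCA:
  "\<mu> x (l y v) - l y (\<mu> x v) + \<mu> (x \<odot> y) v - \<mu> (y \<odot> x) v = \<mu> x (\<mu> (P y) v)"
  "\<mu> x (r z v) - r (x \<cdot> z) v + (\<mu> z (l x v) - \<mu> z (r x v)) = \<mu> x (\<mu> z (\<alpha> v))"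
  "\<mu> (y \<odot> z) v - l y (\<mu> z v) + (\<mu> z (r y v) - \<mu> z (l y v)) = \<mu> (P y) (\<mu> z v)"
  "l (x \<cdot> y) v - l y (\<mu> x v) - l x (\<mu> y v) + \<beta> (\<mu> x (\<mu> y v)) = 0"
  "r z (\<mu> x v) - r (x \<cdot> z) v - l x (\<mu> z v) + \<beta> (\<mu> x (\<mu> z v)) = 0"
  using SD.PCA_1[of "(x, 0)" "(y, 0)" "(0, v)"] SD.PCA_1[of "(x, 0)" "(0, v)" "(z, 0)"]
    SD.PCA_1[of "(0, v)" "(y, 0)" "(z, 0)"] SD.PCA_2[of "(x, 0)" "(y, 0)" "(0, v)"]
    SD.PCA_2[of "(x, 0)" "(0, v)" "(z, 0)"]
  by (simp_all add: semidirect_simps rep_mult algebra_simps)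

section \<open>Dual basis and the carrier of the semi-direct product\<close>

interpretation prod: vector_space_prod sA "dual_scale :: 'k \<Rightarrow> ('v \<Rightarrow> 'k) \<Rightarrow> 'v \<Rightarrow> 'k"
  by unfold_locales

lemmas hat_simps = semidirect_mult_def semidirect_circ_def sub_adjacent_def dual_rep_def
  transpose_map_def prod.scale_def zero_prod_def fun_eq_iff dual_scale_def lin_simps

abbreviation "coord b \<equiv> \<lambda>w. V.representation B w b"

lemma coord_in_dual: "coord b \<in> dual_space sV"
  using V.linear_representation[OF V.independent_Basis V.span_Basis] by (simp add: dual_space_def)

lemma basis_expansion: "(\<Sum>b\<in>B. sV (coord b v) b) = v"
  using V.sum_representation_eq[of B v B] V.independent_Basis V.span_Basis V.finite_Basis by simp

lemma dual_expansion:
  assumes "f \<in> dual_space sV"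
  shows "f = (\<Sum>b\<in>B. dual_scale (f b) (coord b))"
proof
  fix v
  interpret f: Vector_Spaces.linear sV "(*)" f using assms by (simp add: dual_space_def)
  have "f v = f (\<Sum>b\<in>B. sV (coord b v) b)" by (simp add: basis_expansion)
  also have "\<dots> = (\<Sum>b\<in>B. dual_scale (f b) (coord b) v)"
    by (simp add: f.sum f.scale dual_scale_def mult.commute)
  finally show "f v = (\<Sum>b\<in>B. dual_scale (f b) (coord b)) v"
    by (simp add: sum_fun_apply)
qed

lemma hat_vector_space: "fd_vector_space_on hscale hS"
proof unfold_locales
  show sub: "prod.p.subspace hS"
    by (intro prod.subspace_Times subspace_UNIV V.subspace_dual_space)
  obtain C where C: "finite C" "span C = UNIV"
    using finite_dim_carrier by auto
  \<comment> \<open>A spanning set of \<open>A\<close> together with the coordinate functionals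
    spans the sum, since every functional is a combination of coordinates.\<close>
  define G where "G = (\<lambda>x. (x, 0 :: 'v \<Rightarrow> 'k)) ` C \<union> (\<lambda>b. (0, coord b)) ` B"
  have "(x, 0) \<in> prod.p.span G" for x
  proof (rule span_induct[of x C "\<lambda>x. (x, 0) \<in> prod.p.span G"])
    show "subspace {x. (x, 0) \<in> prod.p.span G}"
    proof (rule subspaceI, goal_cases)
      case 1 then show ?case using prod.p.span_zero by (simp add: zero_prod_def)
    next
      case (2 x y) then show ?case using prod.p.span_add[of "(x, 0)" G "(y, 0)"] by simp
    next
      case (3 c x) then show ?case using prod.p.span_scale[of "(x, 0)" G c] by (simp add: prod.scale_def)
    qed
  qed (auto simp: C G_def intro: prod.p.span_base)
  moreover have "(0, f) \<in> prod.p.span G" if "f \<in> dual_space sV" for f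
  proof -
    \<comment> \<open>Induction over subsets of the basis turns the sum inside the second component
      into a sum of pairs.\<close>
    have "(0, \<Sum>b\<in>B'. dual_scale (f b) (coord b)) \<in> prod.p.span G" if "finite B'" "B' \<subseteq> B" for B'
      using that
    proof induction
      case empty then show ?case using prod.p.span_zero[of G] by (simp add: zero_prod_def zero_fun_def)
    next
      case (insert b B')
      have "(0, coord b) \<in> prod.p.span G" using insert by (auto simp: G_def intro: prod.p.span_base)
      from prod.p.span_add[OF prod.p.span_scale[OF this, of "f b"] insert(3)] insert show ?case
        by (simp add: prod.scale_prod plus_fun_def)
    qed
    from this[OF V.finite_Basis order_refl] show ?thesis using dual_expansion[OF that] by simp
  qed
  ultimately have "hS \<subseteq> prod.p.span G"
    using prod.p.span_add[of "(x, 0)" G "(0, f)" for x f] by fastforce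
  moreover have "prod.p.span G \<subseteq> hS"
    by (rule prod.p.span_minimal[OF _ sub])
       (auto simp: G_def coord_in_dual dual.subspace_0[OF V.subspace_dual_space])
  ultimately show "\<exists>B. finite B \<and> hS = prod.p.span B"
    using C V.finite_Basis by (intro exI[of _ G]) (auto simp: G_def)
qed

section \<open>Axioms of the semi-direct product with the dual\<close>

lemma hat_bilinear:
  "bilinear_on hscale hS hscale hS hdot" "bilinear_on hscale hS hscale hS hcirc"
  "linear_on hscale hS hscale hS hP" "linear_on hscale hS hscale hS hQ"
  by (auto simp: bilinear_on_def linear_on_def hat_simps V.dual_space_iff algebra_simps)

text \<open>The component in \<open>A\<close> is the axiom of \<open>A\<close>. The component in the
  dual is evaluated at \<open>v\<close>, where composed actions appear in reverse order, and it
  separates into parts carried by the functionals \<open>f\<close>, \<open>g\<close>,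
  \<open>h\<close>.\<close>

lemma hat_anti_pre_Lie: "anti_pre_Lie_algebra hscale hS hcirc"
proof -
  interpret fd_vector_space_on hscale hS by (rule hat_vector_space)
  show ?thesis
  proof (unfold_locales, goal_cases)
    case 1 show ?case by (rule hat_bilinear)
  next
    case (2 X Y Z)
    obtain x f y g z h where XYZ: "X = (x, f)" "Y = (y, g)" "Z = (z, h)"
      and f: "f \<in> dual_space sV" and g: "g \<in> dual_space sV" and h: "h \<in> dual_space sV"
      using 2 by auto
    note D = dual_spaceD[OF f] dual_spaceD[OF g] dual_spaceD[OF h]
    show ?case
      unfolding XYZ
      apply (simp add: hat_simps D)
      apply (rule conjI)
      subgoal using anti_pre_Lie_1[of x y z] by (simp add: sub_adjacent_def lin_simps)
      apply (rule allI)
      subgoal for v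
        \<comment> \<open>Each functional is applied to the operator identities of its own part; a
          linear combination of the resulting scalar equations is the goal.\<close>
        using arg_cong[OF rep_circ(1)[of x y v], of h] arg_cong[OF rep_circ(2)[of x y v], of h]
          arg_cong[OF rep_circ(2)[of y x v], of h] arg_cong[OF rep_circ(3)[of x y v], of h]
          arg_cong[OF rep_circ(2)[of x z v], of g] arg_cong[OF rep_circ(2)[of y z v], of f]
        apply (simp only: D)
        by (algebra | simp add: algebra_simps)
      done
  next
    case (3 X Y Z)
    obtain x f y g z h where XYZ: "X = (x, f)" "Y = (y, g)" "Z = (z, h)"
      and f: "f \<in> dual_space sV" and g: "g \<in> dual_space sV" and h: "h \<in> dual_space sV"
      using 3 by auto
    note D = dual_spaceD[OF f] dual_spaceD[OF g] dual_spaceD[OF h]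
    show ?case
      unfolding XYZ
      apply (simp add: hat_simps D)
      apply (rule conjI)
      subgoal using anti_pre_Lie_2[of x y z] by (simp add: sub_adjacent_def lin_simps)
      apply (rule allI)
      subgoal for v
        \<comment> \<open>By cyclic symmetry the three functionals meet the same identities with
          permuted arguments.\<close>
        using arg_cong[OF rep_circ(2)[of x y v], of h] arg_cong[OF rep_circ(2)[of y x v], of h]
          arg_cong[OF rep_circ(3)[of x y v], of h]
          arg_cong[OF rep_circ(2)[of x z v], of g] arg_cong[OF rep_circ(2)[of z x v], of g]
          arg_cong[OF rep_circ(3)[of z x v], of g]
          arg_cong[OF rep_circ(2)[of y z v], of f] arg_cong[OF rep_circ(2)[of z y v], of f]
          arg_cong[OF rep_circ(3)[of y z v], of f]
        apply (simp only: D)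
        by (algebra | simp add: algebra_simps)
      done
  qed
qed

text \<open>Transposition permutes the identities of the representation: the derivation rules come
  from \<open>rep_PQ\<close>, the relative Leibniz rule from \<open>rep_PCA\<close>, and the two
  conditions \<open>PCA_1\<close>, \<open>PCA_2\<close> from \<open>rep_Leibniz\<close> together
  with \<open>rep_PCA\<close>.\<close>

lemma hat_relative_PCA: "relative_PCA_algebra hscale hS hdot hcirc hP hQ"
proof -
  interpret H: anti_pre_Lie_algebra hscale hS hcirc by (rule hat_anti_pre_Lie)
  interpret HL: lie_algebra_on hscale hS "sub_adjacent hcirc" by (rule H.lie_algebra_sub_adjacent)
  show ?thesis
  proof (unfold_locales, goal_cases)
    case 1 show ?case by (rule hat_bilinear)
  next
    case (2 X Y)
    then show ?case by (auto simp: hat_simps mult_comm)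
  next
    case (3 X Y Z)
    obtain x f y g z h where XYZ: "X = (x, f)" "Y = (y, g)" "Z = (z, h)"
      and f: "f \<in> dual_space sV" and g: "g \<in> dual_space sV" and h: "h \<in> dual_space sV"
      using 3 by auto
    note D = dual_spaceD[OF f] dual_spaceD[OF g] dual_spaceD[OF h]
    show ?case
      unfolding XYZ
      apply (simp add: hat_simps D rep_mult(1))
      apply (rule conjI)
      subgoal using mult_assoc[of x y z] by (simp add: sub_adjacent_def lin_simps)
      apply (rule allI)
      subgoal for v
        using arg_cong[OF rep_mult(2)[of "y" "z" "v"], of f]
          arg_cong[OF rep_mult(2)[of "x" "z" "v"], of g]
          arg_cong[OF rep_mult(2)[of "x" "y" "v"], of h]
        by (simp add: D add.commute)
      done
  next
    case 4 show ?case by (rule hat_bilinear)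
  next
    case (5 X Y)
    obtain x f y g where XYZ: "X = (x, f)" "Y = (y, g)"
      and f: "f \<in> dual_space sV" and g: "g \<in> dual_space sV"
      using 5 by auto
    note D = dual_spaceD[OF f] dual_spaceD[OF g]
    show ?case
      unfolding XYZ
      apply (simp add: hat_simps D rep_mult(1))
      apply (rule conjI)
      subgoal using P_derivation_mult[of x y] by (simp add: sub_adjacent_def lin_simps)
      apply (rule allI)
      subgoal for v
        \<comment> \<open>\<open>hP\<close> acts on functionals through \<beta>, so both functionals
          test the compatibility of \<beta> with \<mu>.\<close>
        using arg_cong[OF rep_PQ(1)[of x v], of g]
          arg_cong[OF rep_PQ(1)[of y v], of f]
        apply (simp only: D)
        by (algebra | simp add: algebra_simps)
      done
  next
    case (6 X Y)
    obtain x f y g where XYZ: "X = (x, f)" "Y = (y, g)"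
      and f: "f \<in> dual_space sV" and g: "g \<in> dual_space sV"
      using 6 by auto
    note D = dual_spaceD[OF f] dual_spaceD[OF g]
    show ?case
      unfolding XYZ
      apply (simp add: hat_simps D rep_mult(1))
      apply (rule conjI)
      subgoal using P_derivation_bracket[of x y] by (simp add: sub_adjacent_def lin_simps)
      apply (rule allI)
      subgoal for v
        using arg_cong[OF rep_PQ(3)[of x v], of g]
          arg_cong[OF rep_PQ(3)[of y v], of f]
        apply (simp only: D)
        by (algebra | simp add: algebra_simps)
      done
  next
    case (7 X Y Z)
    obtain x f y g z h where XYZ: "X = (x, f)" "Y = (y, g)" "Z = (z, h)"
      and f: "f \<in> dual_space sV" and g: "g \<in> dual_space sV" and h: "h \<in> dual_space sV"
      using 7 by auto
    note D = dual_spaceD[OF f] dual_spaceD[OF g] dual_spaceD[OF h]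
    show ?case
      unfolding XYZ
      apply (simp add: hat_simps D rep_mult(1))
      apply (rule conjI)
      subgoal using relative_Leibniz[of x y z] by (simp add: sub_adjacent_def lin_simps)
      apply (rule allI)
      subgoal for v
        \<comment> \<open>In the bracket of an element of \<open>A\<close> with a functional only
          \<open>l\<close> survives, so the part of \<open>h\<close> is \<open>rep_PCA(4)\<close>
          and those of \<open>f\<close> and \<open>g\<close> are \<open>rep_PCA(1)\<close>.\<close>
        using arg_cong[OF rep_PCA(4)[of x y v], of h]
          arg_cong[OF rep_PCA(4)[of y x v], of h]
          arg_cong[OF rep_PCA(1)[of y z v], of f]
          arg_cong[OF rep_PCA(1)[of x z v], of g]
          arg_cong[OF rep_mult(2)[of "x" "y" "v"], of h]
          arg_cong[OF rep_mult(2)[of "y" "P z" "v"], of f]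
          arg_cong[OF rep_mult(2)[of "x" "P z" "v"], of g]
        apply (simp only: D)
        by (algebra | simp add: algebra_simps)
      done
  next
    case 8 show ?case by (rule hat_bilinear)
  next
    case (9 X Y)
    obtain x f y g where XYZ: "X = (x, f)" "Y = (y, g)"
      and f: "f \<in> dual_space sV" and g: "g \<in> dual_space sV"
      using 9 by auto
    note D = dual_spaceD[OF f] dual_spaceD[OF g]
    show ?case
      unfolding XYZ
      apply (simp add: hat_simps D rep_mult(1))
      apply (rule conjI)
      subgoal using PQ_mult[of x y] by (simp add: sub_adjacent_def lin_simps)
      apply (rule allI)
      subgoal for v
        \<comment> \<open>\<open>hQ\<close> acts on \<open>g\<close> through \<alpha>, which calls
          for the derivation rule of \<alpha>; \<open>f\<close> is multiplied by \<open>Q y\<close>,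
          which calls for \<open>rep_PQ\<close>.\<close>
        using arg_cong[OF rep_P(1)[of x v], of g]
          arg_cong[OF rep_PQ(2)[of y v], of f]
        apply (simp only: D)
        by (algebra | simp add: algebra_simps)
      done
  next
    case (10 X Y)
    obtain x f y g where XYZ: "X = (x, f)" "Y = (y, g)"
      and f: "f \<in> dual_space sV" and g: "g \<in> dual_space sV"
      using 10 by auto
    note D = dual_spaceD[OF f] dual_spaceD[OF g]
    show ?case
      unfolding XYZ
      apply (simp add: hat_simps D rep_mult(1))
      apply (rule conjI)
      subgoal using PQ_circ[of x y] by (simp add: sub_adjacent_def lin_simps)
      apply (rule allI)
      subgoal for v
        using arg_cong[OF rep_P(2)[of x v], of g]
          arg_cong[OF rep_PQ(4)[of y v], of f]
        apply (simp only: D)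
        by (algebra | simp add: algebra_simps)
      done
  next
    case (11 X Y Z)
    obtain x f y g z h where XYZ: "X = (x, f)" "Y = (y, g)" "Z = (z, h)"
      and f: "f \<in> dual_space sV" and g: "g \<in> dual_space sV" and h: "h \<in> dual_space sV"
      using 11 by auto
    note D = dual_spaceD[OF f] dual_spaceD[OF g] dual_spaceD[OF h]
    show ?case
      unfolding XYZ
      apply (simp add: hat_simps D rep_mult(1))
      apply (rule conjI)
      subgoal using PCA_1[of x y z] by (simp add: sub_adjacent_def lin_simps)
      apply (rule allI)
      subgoal for v
        \<comment> \<open>The part of \<open>h\<close> is the relative Leibniz rule of the
          representation, while \<open>g\<close> and \<open>f\<close> meet \<open>rep_PCA\<close>
          again.\<close>
        using arg_cong[OF rep_Leibniz(2)[of y x v], of h]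
          arg_cong[OF rep_PCA(5)[of z x v], of g]
          arg_cong[OF rep_PCA(3)[of y z v], of f]
          arg_cong[OF rep_mult(2)[of "x" "P y" "v"], of h]
          arg_cong[OF rep_mult(2)[of "x" "z" "v"], of g]
          arg_cong[OF rep_mult(2)[of "P y" "z" "v"], of f]
        apply (simp only: D)
        by (algebra | simp add: algebra_simps)
      done
  next
    case (12 X Y Z)
    obtain x f y g z h where XYZ: "X = (x, f)" "Y = (y, g)" "Z = (z, h)"
      and f: "f \<in> dual_space sV" and g: "g \<in> dual_space sV" and h: "h \<in> dual_space sV"
      using 12 by auto
    note D = dual_spaceD[OF f] dual_spaceD[OF g] dual_spaceD[OF h]
    show ?case
      unfolding XYZ
      apply (simp add: hat_simps D rep_mult(1))
      apply (rule conjI)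
      subgoal using PCA_2[of x y z] by (simp add: sub_adjacent_def lin_simps)
      apply (rule allI)
      subgoal for v
        \<comment> \<open>As \<open>hQ\<close> acts through \<alpha>, the operators \<mu> are
          commuted both when applied to \<open>\<alpha> v\<close> and inside the argument of
          \<alpha>.\<close>
        using arg_cong[OF rep_Leibniz(1)[of x y v], of h]
          arg_cong[OF rep_PCA(2)[of x z v], of g]
          arg_cong[OF rep_PCA(2)[of y z v], of f]
          arg_cong[OF rep_mult(2)[of "x" "y" "\<alpha> v"], of h]
          arg_cong[OF rep_mult(2)[of "x" "z" "\<alpha> v"], of g]
          arg_cong[OF rep_mult(2)[of "y" "z" "\<alpha> v"], of f]
          arg_cong[OF arg_cong[OF rep_mult(2)[of "x" "y" "v"], of "\<alpha>"], of h]
          arg_cong[OF rep_mult(2)[of "x" "z" "v"], of g]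
        apply (simp only: D)
        by (algebra | simp add: algebra_simps)
      done
  qed
qed
end

section \<open>O-operators and the Yang-Baxter equation\<close>

locale relative_PCA_rep_map = relative_PCA_rep sA sV dot circ P Q B \<mu> l r \<alpha> \<beta>
  for sA :: "'k::{field_char_0, alg_closed_field} \<Rightarrow> 'a::ab_group_add \<Rightarrow> 'a"
    and sV :: "'k \<Rightarrow> 'v::ab_group_add \<Rightarrow> 'v"
    and dot circ :: "'a \<Rightarrow> 'a \<Rightarrow> 'a" and P Q :: "'a \<Rightarrow> 'a" and B :: "'v set"
    and \<mu> l r :: "'a \<Rightarrow> 'v \<Rightarrow> 'v" and \<alpha> \<beta> :: "'v \<Rightarrow> 'v" +
  fixes T :: "'v \<Rightarrow> 'a"
  assumes T: "Vector_Spaces.linear sV sA T"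
begin

interpretation T: Vector_Spaces.linear sV sA T by (rule T)

lemmas T_simps = T.add T.scale T.diff T.neg T.zero

interpretation prod: vector_space_prod sA "dual_scale :: 'k \<Rightarrow> ('v \<Rightarrow> 'k) \<Rightarrow> 'v \<Rightarrow> 'k"
  by unfold_locales

interpretation H: relative_PCA_algebra hscale hS hdot hcirc hP hQ by (rule hat_relative_PCA)

section \<open>Moving endomorphisms across the tensor of \<open>T\<close>\<close>

abbreviation emA :: "'a \<Rightarrow> 'a \<times> ('v \<Rightarrow> 'k)" where "emA x \<equiv> (x, 0)"
abbreviation emD :: "('v \<Rightarrow> 'k) \<Rightarrow> 'a \<times> ('v \<Rightarrow> 'k)" where "emD f \<equiv> (0, f)"

lemma zero_in_dual [simp]: "0 \<in> dual_space sV"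
  by (rule dual.subspace_0[OF V.subspace_dual_space])

lemma dual_comp:
  assumes "f \<in> dual_space sV" "linear_on sV UNIV sV UNIV N"
  shows "(\<lambda>u. f (N u)) \<in> dual_space sV"
  using assms dual_spaceD[OF assms(1)] linear_onD[OF assms(2)] by (simp add: V.dual_space_iff)

lemma dual_expand_apply:
  assumes "f \<in> dual_space sV"
  shows "f u = (\<Sum>b\<in>B. f b * coord b u)"
proof -
  have "f u = (\<Sum>b\<in>B. dual_scale (f b) (coord b)) u" using dual_expansion[OF assms] by (rule fun_cong)
  then show ?thesis unfolding sum_fun_apply by (simp add: dual_scale_def)
qed

lemma linear_on_dual_expand:
  assumes h: "linear_on dual_scale (dual_space sV) (*) UNIV h" and f: "f \<in> dual_space sV"
  shows "h f = (\<Sum>b\<in>B. f b * h (coord b))"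
proof -
  note sub = V.subspace_dual_space
  have h0: "h 0 = 0"
    using h unfolding linear_on_def by (metis add_cancel_left_left zero_in_dual add_0)
  \<comment> \<open>Linearity of \<open>h\<close> is given on the dual space, so membership of each
    partial sum is carried along in the induction.\<close>
  have "(\<Sum>b\<in>B'. dual_scale (f b) (coord b)) \<in> dual_space sV \<and>
      h (\<Sum>b\<in>B'. dual_scale (f b) (coord b)) = (\<Sum>b\<in>B'. f b * h (coord b))" if "finite B'" for B'
    using that
  proof induction
    case empty then show ?case using h0 zero_in_dual by (simp add: zero_fun_def)
  next
    case (insert b B')
    have "dual_scale (f b) (coord b) \<in> dual_space sV"
      by (rule dual.subspace_scale[OF sub coord_in_dual])
    then show ?case
      using insert h coord_in_dual[of b] dual.subspace_add[OF sub]
      by (simp add: linear_on_def plus_fun_def)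
  qed
  from this[OF V.finite_Basis] show ?thesis using dual_expansion[OF f] by simp
qed

lemma bilinear_form_parts:
  assumes "bilinear_form hscale hS \<chi>"
  shows "c \<in> hS \<Longrightarrow> (\<lambda>u. \<chi> (emA (T u)) c) \<in> dual_space sV"
    and "linear_on dual_scale (dual_space sV) (*) UNIV (\<lambda>f. \<chi> (emA x) (emD f))"
proof -
  note a = assms[unfolded bilinear_form_def linear_on_def]
  show "(\<lambda>u. \<chi> (emA (T u)) c) \<in> dual_space sV" if "c \<in> hS"
  proof -
    have "\<chi> (emA (x + y)) c = \<chi> (emA x) c + \<chi> (emA y) c" for x y
      using a[THEN conjunct1, rule_format, OF that, THEN conjunct2, THEN conjunct1, rule_format,
          of "emA x" "emA y"] by simp
    moreover have "\<chi> (emA (sA k x)) c = k * \<chi> (emA x) c" for k x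
    proof -
      have "hscale k (emA x) = emA (sA k x)" by (simp add: prod.scale_prod dual.scale_zero_right)
      then show ?thesis using a[THEN conjunct1, rule_format, OF that, THEN conjunct2, THEN conjunct2,
          rule_format, of "emA x" k] by simp
    qed
    ultimately show ?thesis by (simp add: V.dual_space_iff T_simps)
  qed
  have "\<chi> (emA x) (emD (f + g)) = \<chi> (emA x) (emD f) + \<chi> (emA x) (emD g)"
    if "f \<in> dual_space sV" "g \<in> dual_space sV" for f g
    using a[THEN conjunct2, rule_format, of "emA x", THEN conjunct2, THEN conjunct1, rule_format,
          of "emD f" "emD g"] that by simp
  moreover have "\<chi> (emA x) (emD (dual_scale k f)) = k * \<chi> (emA x) (emD f)"
    if "f \<in> dual_space sV" for k f
  proof -
    have "hscale k (emD f) = emD (dual_scale k f)" by (simp add: prod.scale_prod)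
    then show ?thesis using that a[THEN conjunct2, rule_format, of "emA x", THEN conjunct2,
          THEN conjunct2, rule_format, of "emD f" k] by simp
  qed
  ultimately show "linear_on dual_scale (dual_space sV) (*) UNIV (\<lambda>f. \<chi> (emA x) (emD f))"
    by (simp add: linear_on_def)
qed

text \<open>Both sides equal the double sum over \<open>v\<close>, \<open>w\<close> with
  coefficients \<open>coord v (N w)\<close>: on the left the functional \<open>coord v\<close> after
  \<open>N\<close> is expanded in the dual basis, on the right \<open>N w\<close> in the
  basis.\<close>

lemma tensor_invariance:
  assumes \<chi>: "bilinear_form hscale hS \<chi>" and N: "linear_on sV UNIV sV UNIV N"
  shows "(\<Sum>v\<in>B. \<chi> (emA (T v)) (emD (\<lambda>u. coord v (N u)))) = (\<Sum>v\<in>B. \<chi> (emA (T (N v))) (emD (coord v)))"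
proof -
  have "(\<Sum>v\<in>B. \<chi> (emA (T v)) (emD (\<lambda>u. coord v (N u))))
    = (\<Sum>v\<in>B. \<Sum>w\<in>B. coord v (N w) * \<chi> (emA (T v)) (emD (coord w)))"
    using linear_on_dual_expand[OF bilinear_form_parts(2)[OF \<chi>] dual_comp[OF coord_in_dual N]]
    by (intro sum.cong refl) blast
  also have "\<dots> = (\<Sum>w\<in>B. \<Sum>v\<in>B. \<chi> (emA (T v)) (emD (coord w)) * coord v (N w))"
    by (subst sum.swap) (simp add: mult.commute)
  \<comment> \<open>The first slot of \<open>\<chi>\<close>, pulled back along \<open>T\<close>, is
    a functional on \<open>V\<close>; its expansion at \<open>N w\<close> is read backwards.\<close>
  also have "\<dots> = (\<Sum>w\<in>B. \<chi> (emA (T (N w))) (emD (coord w)))"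
    using coord_in_dual
    by (intro sum.cong refl dual_expand_apply[OF bilinear_form_parts(1)[OF \<chi>], symmetric]) simp
  finally show ?thesis .
qed

lemma tensor_invariance_flip:
  assumes "bilinear_form hscale hS \<chi>" "linear_on sV UNIV sV UNIV N"
  shows "(\<Sum>v\<in>B. \<chi> (emD (\<lambda>u. coord v (N u))) (emA (T v))) = (\<Sum>v\<in>B. \<chi> (emD (coord v)) (emA (T (N v))))"
proof (rule tensor_invariance)
  show "bilinear_form hscale hS (\<lambda>x y. \<chi> y x)"
    using assms(1) unfolding bilinear_form_def by blast
qed (rule assms(2))

section \<open>Detecting vanishing defects by test forms\<close>

lemma functionals_separate:
  assumes "\<And>\<theta>. Vector_Spaces.linear sA (*) \<theta> \<Longrightarrow> \<theta> x = 0"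
  shows "x = 0"
proof -
  \<comment> \<open>Every functional vanishes vacuously on the empty set, whose span is
    zero.\<close>
  have "x \<in> span {}"
    unfolding mem_span_iff_functionals using assms by blast
  then show ?thesis by simp
qed

text \<open>The test form \<open>\<theta> (fst a) * snd b v\<close> kills the terms in
  \<open>F\<close>; on the terms in \<open>E\<close> the sum collapses, by expansion of
  \<open>v\<close>, to \<open>\<theta> (E v)\<close>.\<close>

lemma detect2:
  assumes lin: "Vector_Spaces.linear sV sA E"
    and z: "\<And>\<phi>. bilinear_form hscale hS \<phi> \<Longrightarrow>
      (\<Sum>v\<in>B. \<phi> (emA (E v)) (emD (coord v)) + \<phi> (emD (coord v)) (emA (F v))) = 0"
  shows "E v = 0"
proof (rule functionals_separate)
  fix \<theta> assume "Vector_Spaces.linear sA (*) \<theta>"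
  then have "\<theta> \<in> dual_space sA" by (simp add: dual_space_def)
  note \<theta> = dual_spaceD[OF this]
  interpret E: Vector_Spaces.linear sV sA E by (rule lin)
  have "bilinear_form hscale hS (\<lambda>a b. \<theta> (fst a) * snd b v)"
    by (auto simp: bilinear_form_def linear_on_def prod.scale_def dual_scale_def \<theta> algebra_simps)
  from z[OF this] have "(\<Sum>b\<in>B. \<theta> (E b) * coord b v) = 0" by (simp add: \<theta>)
  moreover have "(\<lambda>u. \<theta> (E u)) \<in> dual_space sV"
    by (simp add: V.dual_space_iff E.add E.scale \<theta>)
  ultimately show "\<theta> (E v) = 0" by (simp add: dual_expand_apply[of "\<lambda>u. \<theta> (E u)" v])
qed

text \<open>The form \<open>\<theta> (fst a) * snd b v * snd c w\<close> kills the terms in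
  \<open>F\<close> and \<open>G\<close>; linearity of \<open>E\<close> in both arguments turns the
  rest into \<open>\<theta> (E v w)\<close>.\<close>

lemma detect3:
  assumes lin: "\<And>w. Vector_Spaces.linear sV sA (\<lambda>v. E v w)" "\<And>v. Vector_Spaces.linear sV sA (E v)"
    and z: "\<And>\<phi>. trilinear_form hscale hS \<phi> \<Longrightarrow>
      (\<Sum>v\<in>B. \<Sum>w\<in>B. \<phi> (emA (E v w)) (emD (coord v)) (emD (coord w))
        + \<phi> (emD (coord v)) (emA (F v w)) (emD (coord w))
        + \<phi> (emD (coord v)) (emD (coord w)) (emA (G v w))) = 0"
  shows "E v w = 0"
proof (rule functionals_separate)
  fix \<theta> assume "Vector_Spaces.linear sA (*) \<theta>"
  then have "\<theta> \<in> dual_space sA" by (simp add: dual_space_def)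
  note \<theta> = dual_spaceD[OF this]
  have "trilinear_form hscale hS (\<lambda>a b c. \<theta> (fst a) * snd b v * snd c w)"
    by (auto simp: trilinear_form_def linear_on_def prod.scale_def dual_scale_def \<theta> algebra_simps)
  from z[OF this] have s: "(\<Sum>a\<in>B. \<Sum>b\<in>B. \<theta> (E a b) * coord a v * coord b w) = 0" by (simp add: \<theta>)
  have "(\<lambda>u. \<theta> (E v u)) \<in> dual_space sV" "(\<lambda>u. \<theta> (E u b)) \<in> dual_space sV" for b
  proof -
    interpret E1: Vector_Spaces.linear sV sA "\<lambda>v. E v b" by (rule lin)
    interpret E2: Vector_Spaces.linear sV sA "E v" by (rule lin)
    show "(\<lambda>u. \<theta> (E v u)) \<in> dual_space sV" "(\<lambda>u. \<theta> (E u b)) \<in> dual_space sV"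
      by (simp_all add: V.dual_space_iff E1.add E1.scale E2.add E2.scale \<theta>)
  qed
  note d = this
  have "\<theta> (E v w) = (\<Sum>b\<in>B. \<theta> (E v b) * coord b w)" by (rule dual_expand_apply[OF d(1)])
  also have "\<dots> = (\<Sum>b\<in>B. \<Sum>a\<in>B. \<theta> (E a b) * coord a v * coord b w)"
    by (simp add: dual_expand_apply[OF d(2), of v] sum_distrib_right)
  finally show "\<theta> (E v w) = 0" using s by (subst (asm) sum.swap) simp
qed

section \<open>The skew tensor and products of its components\<close>

abbreviation ti :: "'v \<Rightarrow> 'a \<times> ('v \<Rightarrow> 'k)" where "ti v \<equiv> emA (T v)"
abbreviation tj :: "'v \<Rightarrow> 'a \<times> ('v \<Rightarrow> 'k)" where "tj v \<equiv> emD (coord v)"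

text \<open>A representative of \<open>T\<close> minus its flip in the free space:
  \<open>tj v\<close> is the dual basis vector and \<open>ti v\<close> is its companion
  \<open>T v\<close>.\<close>

definition skew_rep :: "('a \<times> ('v \<Rightarrow> 'k)) \<times> ('a \<times> ('v \<Rightarrow> 'k)) \<Rightarrow>\<^sub>0 'k"
  where "skew_rep = (\<Sum>v\<in>B. free_gen (tj v, ti v) - free_gen (ti v, tj v))"

definition dsum :: "('v \<Rightarrow> 'v \<Rightarrow> 'k) \<Rightarrow> 'k"
  where "dsum F = (\<Sum>v\<in>B. \<Sum>w\<in>B. F v w)"

lemma dsum_linear:
  "dsum (\<lambda>v w. F v w + G v w) = dsum F + dsum G"
  "dsum (\<lambda>v w. F v w - G v w) = dsum F - dsum G"
  "dsum (\<lambda>v w. - F v w) = - dsum F"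
  "dsum (\<lambda>v w. 0) = 0"
  by (simp_all add: dsum_def sum.distrib sum_subtractf sum_negf)

lemma dsum_swap: "dsum F = dsum (\<lambda>v w. F w v)"
  unfolding dsum_def by (rule sum.swap)

lemma skew_tensor:
  "coset_diff (map_tensor sA sV B T) (tensor2_flip hscale hS (map_tensor sA sV B T))
    = coset (tensor2_null hscale hS) skew_rep"
  unfolding map_tensor_def tensor2_flip_coset coset_diff_coset[OF subspace_tensor2_null]
    coset_eq_iff[OF subspace_tensor2_null] tensor2_null_iff skew_rep_def
  by (simp add: case_prod_unfold sum_subtractf)

lemma keys_skew_rep: "Poly_Mapping.keys skew_rep \<subseteq> hS \<times> hS"
proof -
  have "Poly_Mapping.keys (free_gen (tj v, ti v) - free_gen (ti v, tj v) :: _ \<Rightarrow>\<^sub>0 'k) \<subseteq> hS \<times> hS" for v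
    by (rule order_trans[OF keys_diff]) (auto simp: coord_in_dual)
  then show ?thesis
    unfolding skew_rep_def by (intro order_trans[OF keys_sum]) blast
qed

lemma lin_ext_skew_rep: "lin_ext \<phi> skew_rep = (\<Sum>v\<in>B. \<phi> (tj v, ti v) - \<phi> (ti v, tj v))"
  by (simp add: skew_rep_def)

lemma lin_ext2_skew_rep:
  "lin_ext2 \<Psi> skew_rep skew_rep = dsum (\<lambda>v w. \<Psi> (tj v) (ti v) (tj w) (ti w) - \<Psi> (tj v) (ti v) (ti w) (tj w)
    - (\<Psi> (ti v) (tj v) (tj w) (ti w) - \<Psi> (ti v) (tj v) (ti w) (tj w)))"
  by (simp add: lin_ext2_def lin_ext_skew_rep dsum_def sum_subtractf)

text \<open>The sign in \<open>dual_rep\<close> cancels the one in front of \<mu>. The product of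
  two functionals is written \<open>emA 0\<close>, a zero on which linearity in \<open>A\<close>
  acts.\<close>

lemma hdot_simps:
  "hdot (emA x) (emA y) = emA (dot x y)"
  "f \<in> dual_space sV \<Longrightarrow> hdot (emA x) (emD f) = emD (\<lambda>u. f (\<mu> x u))"
  "f \<in> dual_space sV \<Longrightarrow> hdot (emD f) (emA x) = emD (\<lambda>u. f (\<mu> x u))"
  "f \<in> dual_space sV \<Longrightarrow> g \<in> dual_space sV \<Longrightarrow> hdot (emD f) (emD g) = emA 0"
  by (auto simp: hat_simps dual_spaceD)

lemma hcirc_simps:
  "hcirc (emA x) (emA y) = emA (circ x y)"
  "f \<in> dual_space sV \<Longrightarrow> hcirc (emA x) (emD f) = emD (\<lambda>u. f (l x u - r x u))"
  "f \<in> dual_space sV \<Longrightarrow> hcirc (emD f) (emA x) = emD (\<lambda>u. f (- r x u))"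
  "f \<in> dual_space sV \<Longrightarrow> g \<in> dual_space sV \<Longrightarrow> hcirc (emD f) (emD g) = emA 0"
  by (auto simp: hat_simps dual_spaceD)

text \<open>The left and right actions on a functional are given by \<open>l - r\<close> and
  \<open>- r\<close> on \<open>V\<close>, so \<open>r\<close> cancels in their difference.\<close>

lemma hbracket_simps:
  "sub_adjacent hcirc (emA x) (emA y) = emA (circ x y - circ y x)"
  "f \<in> dual_space sV \<Longrightarrow> sub_adjacent hcirc (emA x) (emD f) = emD (\<lambda>u. f (l x u))"
  "f \<in> dual_space sV \<Longrightarrow> sub_adjacent hcirc (emD f) (emA x) = emD (\<lambda>u. f (- l x u))"
  "f \<in> dual_space sV \<Longrightarrow> g \<in> dual_space sV \<Longrightarrow> sub_adjacent hcirc (emD f) (emD g) = emA 0"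
  by (auto simp: hat_simps dual_spaceD)

lemma tj_in_hS: "tj v \<in> hS"
  by (simp add: coord_in_dual)

lemma trilinear_emA:
  assumes "trilinear_form hscale hS \<phi>" "b \<in> hS" "c \<in> hS"
  shows "linear_on sA UNIV (*) UNIV (\<lambda>x. \<phi> (emA x) b c)"
    "linear_on sA UNIV (*) UNIV (\<lambda>x. \<phi> b (emA x) c)"
    "linear_on sA UNIV (*) UNIV (\<lambda>x. \<phi> b c (emA x))"
proof -
  have e: "emA (x + y) = emA x + emA y" "emA (sA k x) = hscale k (emA x)" "emA x \<in> hS" for x y k
    by (simp_all add: hat_simps)
  show "linear_on sA UNIV (*) UNIV (\<lambda>x. \<phi> (emA x) b c)"
    "linear_on sA UNIV (*) UNIV (\<lambda>x. \<phi> b (emA x) c)"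
    "linear_on sA UNIV (*) UNIV (\<lambda>x. \<phi> b c (emA x))"
    unfolding linear_on_def e(1,2)
    by (intro conjI ballI allI UNIV_I trilinear_formD[OF assms(1)] assms(2,3) e(3))+
qed

text \<open>The six arrangements serve the six mixed terms of each Yang-Baxter expression, where one
  slot holds a dual basis vector and an endomorphism is moved between the other two.\<close>

lemma trilinear_slots:
  assumes "trilinear_form hscale hS \<phi>" "c \<in> hS"
  shows "bilinear_form hscale hS (\<lambda>a b. \<phi> a b c)" "bilinear_form hscale hS (\<lambda>a b. \<phi> b a c)"
    "bilinear_form hscale hS (\<lambda>a b. \<phi> a c b)" "bilinear_form hscale hS (\<lambda>a b. \<phi> b c a)"
    "bilinear_form hscale hS (\<lambda>a b. \<phi> c a b)" "bilinear_form hscale hS (\<lambda>a b. \<phi> c b a)"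
  using assms unfolding trilinear_form_def bilinear_form_def by blast+

text \<open>The other index is a parameter of the form and of the endomorphism alike, as for
  \<open>\<mu> (T w)\<close> in the sum over \<open>v\<close>.\<close>

lemma dsum_invariance_outer:
  assumes "\<And>w. bilinear_form hscale hS (\<chi> w)" "\<And>w. linear_on sV UNIV sV UNIV (N w)"
  shows "dsum (\<lambda>v w. \<chi> w (ti v) (emD (\<lambda>u. coord v (N w u)))) = dsum (\<lambda>v w. \<chi> w (emA (T (N w v))) (tj v))"
  unfolding dsum_def by (subst (1 2) sum.swap) (simp add: tensor_invariance assms)

lemma dsum_invariance_inner:
  assumes "\<And>v. bilinear_form hscale hS (\<chi> v)" "\<And>v. linear_on sV UNIV sV UNIV (N v)"
  shows "dsum (\<lambda>v w. \<chi> v (ti w) (emD (\<lambda>u. coord w (N v u)))) = dsum (\<lambda>v w. \<chi> v (emA (T (N v w))) (tj w))"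
  unfolding dsum_def by (simp add: tensor_invariance assms)

lemma action_linear:
  "linear_on sV UNIV sV UNIV (\<mu> x)" "linear_on sV UNIV sV UNIV (l x)"
  "linear_on sV UNIV sV UNIV (\<lambda>u. - l x u)" "linear_on sV UNIV sV UNIV (\<lambda>u. - r x u)"
  "linear_on sV UNIV sV UNIV (\<lambda>u. l x u - r x u)"
  by (simp_all add: linear_on_def lin_simps V.scale_right_diff_distrib)

section \<open>Yang-Baxter expressions in terms of defects\<close>

definition mult_defect :: "'v \<Rightarrow> 'v \<Rightarrow> 'a"
  where "mult_defect v w = dot (T v) (T w) - T (\<mu> (T v) w + \<mu> (T w) v)"

definition circ_defect :: "'v \<Rightarrow> 'v \<Rightarrow> 'a"
  where "circ_defect v w = circ (T v) (T w) - T (l (T v) w + r (T w) v)"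

lemma YB_A_skew_rep:
  assumes \<phi>: "trilinear_form hscale hS \<phi>"
  shows "lin_ext2 (\<lambda>a b a' b'. \<phi> (hdot a a') b b' - \<phi> a (hdot a' b) b' + \<phi> a a' (hdot b b')) skew_rep skew_rep
    = dsum (\<lambda>v w. \<phi> (emA (mult_defect v w)) (tj v) (tj w) + \<phi> (tj v) (emA (mult_defect v w)) (tj w)
        + \<phi> (tj v) (tj w) (emA (mult_defect v w)))"
proof -
  note lin = linear_onD[OF trilinear_emA(1)[OF \<phi>]] linear_onD[OF trilinear_emA(2)[OF \<phi>]]
    linear_onD[OF trilinear_emA(3)[OF \<phi>]]
  note slots = trilinear_slots[OF \<phi> tj_in_hS]
  \<comment> \<open>Of the twelve terms three contain a product of two functionals and vanish, three
    contain a product of values of \<open>T\<close>, and six are mixed. In each mixed term the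
    action is moved from the dual onto \<open>V\<close>.\<close>
  have inv:
    "dsum (\<lambda>v w. \<phi> (ti v) (emD (\<lambda>u. coord v (\<mu> (T w) u))) (tj w)) = dsum (\<lambda>v w. \<phi> (emA (T (\<mu> (T w) v))) (tj v) (tj w))"
    "dsum (\<lambda>v w. \<phi> (tj v) (emD (\<lambda>u. coord w (\<mu> (T v) u))) (ti w)) = dsum (\<lambda>v w. \<phi> (tj v) (tj w) (emA (T (\<mu> (T v) w))))"
    "dsum (\<lambda>v w. \<phi> (emD (\<lambda>u. coord v (\<mu> (T w) u))) (ti v) (tj w)) = dsum (\<lambda>v w. \<phi> (tj v) (emA (T (\<mu> (T w) v))) (tj w))"
    "dsum (\<lambda>v w. \<phi> (tj v) (ti w) (emD (\<lambda>u. coord w (\<mu> (T v) u)))) = dsum (\<lambda>v w. \<phi> (tj v) (emA (T (\<mu> (T v) w))) (tj w))"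
    "dsum (\<lambda>v w. \<phi> (emD (\<lambda>u. coord w (\<mu> (T v) u))) (tj v) (ti w)) = dsum (\<lambda>v w. \<phi> (tj w) (tj v) (emA (T (\<mu> (T v) w))))"
    "dsum (\<lambda>v w. \<phi> (ti v) (tj w) (emD (\<lambda>u. coord v (\<mu> (T w) u)))) = dsum (\<lambda>v w. \<phi> (emA (T (\<mu> (T w) v))) (tj w) (tj v))"
    by (rule dsum_invariance_outer[OF slots(1) action_linear(1)] dsum_invariance_inner[OF slots(6) action_linear(1)]
      dsum_invariance_outer[OF slots(2) action_linear(1)] dsum_invariance_inner[OF slots(5) action_linear(1)]
      dsum_invariance_inner[OF slots(4) action_linear(1)] dsum_invariance_outer[OF slots(3) action_linear(1)])+
  \<comment> \<open>Two of the moved terms carry their dual basis vectors in reverse order; renaming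
    the indices restores it and supplies the missing half of a defect.\<close>
  have swap:
    "dsum (\<lambda>v w. \<phi> (tj w) (tj v) (emA (T (\<mu> (T v) w)))) = dsum (\<lambda>v w. \<phi> (tj v) (tj w) (emA (T (\<mu> (T w) v))))"
    "dsum (\<lambda>v w. \<phi> (emA (T (\<mu> (T w) v))) (tj w) (tj v)) = dsum (\<lambda>v w. \<phi> (emA (T (\<mu> (T v) w))) (tj v) (tj w))"
    by (rule dsum_swap)+
  show ?thesis
    by (simp add: lin_ext2_skew_rep hdot_simps coord_in_dual mult_defect_def T.add lin dsum_linear inv swap
        mult_comm algebra_simps)
qed

text \<open>The same sorting into twelve terms. As \<open>circ\<close> need not be commutative, the
  three positions carry different combinations; the bracket in the last slot produces the
  antisymmetrized defect.\<close>

lemma YB_T_skew_rep: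
  assumes \<phi>: "trilinear_form hscale hS \<phi>"
  shows "lin_ext2 (\<lambda>a b a' b'. \<phi> (hcirc a a') b b' + \<phi> a (hcirc b a') b' - \<phi> a a' (sub_adjacent hcirc b b'))
      skew_rep skew_rep
    = dsum (\<lambda>v w. \<phi> (emA (circ_defect v w)) (tj v) (tj w) + \<phi> (tj v) (emA (- circ_defect v w)) (tj w)
        + \<phi> (tj v) (tj w) (emA (circ_defect w v - circ_defect v w)))"
proof -
  note lin = linear_onD[OF trilinear_emA(1)[OF \<phi>]] linear_onD[OF trilinear_emA(2)[OF \<phi>]]
    linear_onD[OF trilinear_emA(3)[OF \<phi>]]
  note slots = trilinear_slots[OF \<phi> tj_in_hS]
  have inv:
    "dsum (\<lambda>v w. \<phi> (tj v) (emD (\<lambda>u. coord w (l (T v) u - r (T v) u))) (ti w))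
      = dsum (\<lambda>v w. \<phi> (tj v) (tj w) (emA (T (l (T v) w - r (T v) w))))"
    "dsum (\<lambda>v w. \<phi> (emD (\<lambda>u. coord v (- r (T w) u))) (ti v) (tj w))
      = dsum (\<lambda>v w. \<phi> (tj v) (emA (T (- r (T w) v))) (tj w))"
    "dsum (\<lambda>v w. \<phi> (tj v) (ti w) (emD (\<lambda>u. coord w (l (T v) u))))
      = dsum (\<lambda>v w. \<phi> (tj v) (emA (T (l (T v) w))) (tj w))"
    "dsum (\<lambda>v w. \<phi> (emD (\<lambda>u. coord w (l (T v) u - r (T v) u))) (tj v) (ti w))
      = dsum (\<lambda>v w. \<phi> (tj w) (tj v) (emA (T (l (T v) w - r (T v) w))))"
    "dsum (\<lambda>v w. \<phi> (ti v) (tj w) (emD (\<lambda>u. coord v (- l (T w) u))))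
      = dsum (\<lambda>v w. \<phi> (emA (T (- l (T w) v))) (tj w) (tj v))"
    "dsum (\<lambda>v w. \<phi> (ti v) (emD (\<lambda>u. coord v (- r (T w) u))) (tj w))
      = dsum (\<lambda>v w. \<phi> (emA (T (- r (T w) v))) (tj v) (tj w))"
    by (rule dsum_invariance_inner[OF slots(6) action_linear(5)] dsum_invariance_outer[OF slots(2) action_linear(4)]
      dsum_invariance_inner[OF slots(5) action_linear(2)] dsum_invariance_inner[OF slots(4) action_linear(5)]
      dsum_invariance_outer[OF slots(3) action_linear(3)] dsum_invariance_outer[OF slots(1) action_linear(4)])+
  have swap:
    "dsum (\<lambda>v w. \<phi> (tj w) (tj v) (emA (T (l (T v) w - r (T v) w))))
      = dsum (\<lambda>v w. \<phi> (tj v) (tj w) (emA (T (l (T w) v - r (T w) v))))"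
    "dsum (\<lambda>v w. \<phi> (emA (T (- l (T w) v))) (tj w) (tj v))
      = dsum (\<lambda>v w. \<phi> (emA (T (- l (T v) w))) (tj v) (tj w))"
    by (rule dsum_swap)+
  show ?thesis
    apply (simp only: lin_ext2_skew_rep hcirc_simps hbracket_simps coord_in_dual dsum_linear inv swap)
    by (simp add: coord_in_dual circ_defect_def T.add T.diff T.neg lin dsum_linear algebra_simps)
qed

lemma defect_linear:
  "Vector_Spaces.linear sV sA (\<lambda>v. mult_defect v w)" "Vector_Spaces.linear sV sA (mult_defect v)"
  "Vector_Spaces.linear sV sA (\<lambda>v. circ_defect v w)" "Vector_Spaces.linear sV sA (circ_defect v)"
  by (unfold_locales; simp add: mult_defect_def circ_defect_def T.add T.scale lin_simps
      scale_right_distrib scale_right_diff_distrib V.scale_right_distrib V.scale_right_diff_distrib)+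

lemma YB_A_iff:
  "YB_A hscale hS hdot (coset (tensor2_null hscale hS) skew_rep) = tensor3_null hscale hS
    \<longleftrightarrow> (\<forall>v w. mult_defect v w = 0)"
proof -
  have "(\<forall>\<phi>. trilinear_form hscale hS \<phi> \<longrightarrow>
      dsum (\<lambda>v w. \<phi> (emA (mult_defect v w)) (tj v) (tj w) + \<phi> (tj v) (emA (mult_defect v w)) (tj w)
        + \<phi> (tj v) (tj w) (emA (mult_defect v w))) = 0) \<longleftrightarrow> (\<forall>v w. mult_defect v w = 0)" (is "?L \<longleftrightarrow> ?R")
  proof
    assume ?L
    then show ?R
      \<comment> \<open>The defects in the other two positions play the part of the terms that the
        test form kills.\<close>
      unfolding dsum_def by (intro allI detect3[OF defect_linear(1,2),
            where F = mult_defect and G = mult_defect]) blast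
  next
    assume ?R
    then show ?L
      by (simp add: linear_onD(3)[OF trilinear_emA(1)] linear_onD(3)[OF trilinear_emA(2)]
        linear_onD(3)[OF trilinear_emA(3)] coord_in_dual dsum_linear)
  qed
  then show ?thesis
    by (simp add: YB_A_eq_null_iff[OF prod.p.module_axioms H.subspace_carrier keys_skew_rep hat_bilinear(1)]
        YB_A_skew_rep)
qed

lemma YB_T_iff:
  "YB_T hscale hS hcirc (coset (tensor2_null hscale hS) skew_rep) = tensor3_null hscale hS
    \<longleftrightarrow> (\<forall>v w. circ_defect v w = 0)"
proof -
  have "(\<forall>\<phi>. trilinear_form hscale hS \<phi> \<longrightarrow>
      dsum (\<lambda>v w. \<phi> (emA (circ_defect v w)) (tj v) (tj w) + \<phi> (tj v) (emA (- circ_defect v w)) (tj w)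
        + \<phi> (tj v) (tj w) (emA (circ_defect w v - circ_defect v w))) = 0) \<longleftrightarrow> (\<forall>v w. circ_defect v w = 0)"
    (is "?L \<longleftrightarrow> ?R")
  proof
    assume ?L
    then show ?R
      unfolding dsum_def by (intro allI detect3[OF defect_linear(3,4),
            where F = "\<lambda>v w. - circ_defect v w" and G = "\<lambda>v w. circ_defect w v - circ_defect v w"]) blast
  next
    assume ?R
    then show ?L
      by (simp add: linear_onD(3)[OF trilinear_emA(1)] linear_onD(3)[OF trilinear_emA(2)]
        linear_onD(3)[OF trilinear_emA(3)] coord_in_dual dsum_linear)
  qed
  then show ?thesis
    by (simp add: YB_T_eq_null_iff[OF prod.p.module_axioms H.subspace_carrier keys_skew_rep hat_bilinear(2)
        H.bracket_bilinear] YB_T_skew_rep)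
qed

section \<open>The conditions on \<open>P\<close> and \<open>Q\<close>\<close>

lemma bilinear_emA:
  assumes "bilinear_form hscale hS \<phi>" "c \<in> hS"
  shows "linear_on sA UNIV (*) UNIV (\<lambda>x. \<phi> (emA x) c)" "linear_on sA UNIV (*) UNIV (\<lambda>x. \<phi> c (emA x))"
proof -
  have e: "emA (x + y) = emA x + emA y" "emA (sA k x) = hscale k (emA x)" "emA x \<in> hS" for x y k
    by (simp_all add: hat_simps)
  show "linear_on sA UNIV (*) UNIV (\<lambda>x. \<phi> (emA x) c)" "linear_on sA UNIV (*) UNIV (\<lambda>x. \<phi> c (emA x))"
    using assms e(3) unfolding linear_on_def bilinear_form_def e(1,2) by blast+
qed

lemma hP_hQ_simps:
  "hP (emA x) = emA (P x)" "hQ (emA x) = emA (Q x)"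
  "hP (emD f) = emD (\<lambda>u. f (\<beta> u))" "hQ (emD f) = emD (\<lambda>u. f (\<alpha> u))"
  by (simp_all add: transpose_map_def fun_eq_iff lin_simps)

lemma id_linear: "linear_on hscale hS hscale hS id"
  by (simp add: linear_on_def)

text \<open>The transposes of \<alpha> and \<beta> are moved onto \<open>V\<close> by invariance.
  Each condition then contains both defects, in opposite tensor positions.\<close>

lemma PQ_conditions:
  assumes \<phi>: "bilinear_form hscale hS \<phi>"
  shows "lin_ext (\<lambda>(a, b). \<phi> (hQ a) (id b)) skew_rep - lin_ext (\<lambda>(a, b). \<phi> (id a) (hP b)) skew_rep
      = (\<Sum>v\<in>B. \<phi> (emA (T (\<beta> v) - Q (T v))) (tj v) + \<phi> (tj v) (emA (T (\<alpha> v) - P (T v))))"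
    and "lin_ext (\<lambda>(a, b). \<phi> (hP a) (id b)) skew_rep - lin_ext (\<lambda>(a, b). \<phi> (id a) (hQ b)) skew_rep
      = (\<Sum>v\<in>B. \<phi> (emA (T (\<alpha> v) - P (T v))) (tj v) + \<phi> (tj v) (emA (T (\<beta> v) - Q (T v))))"
proof -
  note lin = linear_onD[OF bilinear_emA(1)[OF \<phi>]] linear_onD[OF bilinear_emA(2)[OF \<phi>]]
  note inv = tensor_invariance[OF \<phi> alpha] tensor_invariance[OF \<phi> beta]
    tensor_invariance_flip[OF \<phi> alpha] tensor_invariance_flip[OF \<phi> beta]
  show "lin_ext (\<lambda>(a, b). \<phi> (hQ a) (id b)) skew_rep - lin_ext (\<lambda>(a, b). \<phi> (id a) (hP b)) skew_rep
      = (\<Sum>v\<in>B. \<phi> (emA (T (\<beta> v) - Q (T v))) (tj v) + \<phi> (tj v) (emA (T (\<alpha> v) - P (T v))))"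
    "lin_ext (\<lambda>(a, b). \<phi> (hP a) (id b)) skew_rep - lin_ext (\<lambda>(a, b). \<phi> (id a) (hQ b)) skew_rep
      = (\<Sum>v\<in>B. \<phi> (emA (T (\<alpha> v) - P (T v))) (tj v) + \<phi> (tj v) (emA (T (\<beta> v) - Q (T v))))"
    by (simp_all only: lin_ext_skew_rep case_prod_conv hP_hQ_simps id_apply sum_subtractf inv lin tj_in_hS sum.distrib)
       (simp_all add: algebra_simps)
qed

lemma PQ_defect_linear:
  "Vector_Spaces.linear sV sA (\<lambda>v. T (\<beta> v) - Q (T v))" "Vector_Spaces.linear sV sA (\<lambda>v. T (\<alpha> v) - P (T v))"
  by (unfold_locales; simp add: T.add T.scale lin_simps
      scale_right_distrib scale_right_diff_distrib V.scale_right_distrib V.scale_right_diff_distrib)+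

lemma PQ_iff:
  "(\<forall>\<phi>. bilinear_form hscale hS \<phi> \<longrightarrow>
      lin_ext (\<lambda>(a, b). \<phi> (hQ a) (id b)) skew_rep = lin_ext (\<lambda>(a, b). \<phi> (id a) (hP b)) skew_rep) \<and>
    (\<forall>\<phi>. bilinear_form hscale hS \<phi> \<longrightarrow>
      lin_ext (\<lambda>(a, b). \<phi> (hP a) (id b)) skew_rep = lin_ext (\<lambda>(a, b). \<phi> (id a) (hQ b)) skew_rep)
    \<longleftrightarrow> (\<forall>v. P (T v) = T (\<alpha> v)) \<and> (\<forall>v. Q (T v) = T (\<beta> v))" (is "?L1 \<and> ?L2 \<longleftrightarrow> ?R1 \<and> ?R2")
proof (intro iffI conjI)
  assume L: "?L1 \<and> ?L2"
  \<comment> \<open>Detection reads the defect in the first position, so the equation for \<beta>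
    comes from the first condition and the one for \<alpha> from the second.\<close>
  have "T (\<beta> v) - Q (T v) = 0" for v
  proof (rule detect2[OF PQ_defect_linear(1)])
    fix \<phi> assume \<phi>: "bilinear_form hscale hS \<phi>"
    then have "lin_ext (\<lambda>(a, b). \<phi> (hQ a) (id b)) skew_rep = lin_ext (\<lambda>(a, b). \<phi> (id a) (hP b)) skew_rep"
      using L by blast
    from PQ_conditions(1)[OF \<phi>, unfolded this diff_self]
    show "(\<Sum>v\<in>B. \<phi> (emA (T (\<beta> v) - Q (T v))) (tj v) + \<phi> (tj v) (emA (T (\<alpha> v) - P (T v)))) = 0"
      by (rule sym)
  qed
  then show ?R2 by simp
  have "T (\<alpha> v) - P (T v) = 0" for v
  proof (rule detect2[OF PQ_defect_linear(2)])
    fix \<phi> assume \<phi>: "bilinear_form hscale hS \<phi>"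
    then have "lin_ext (\<lambda>(a, b). \<phi> (hP a) (id b)) skew_rep = lin_ext (\<lambda>(a, b). \<phi> (id a) (hQ b)) skew_rep"
      using L by blast
    from PQ_conditions(2)[OF \<phi>, unfolded this diff_self]
    show "(\<Sum>v\<in>B. \<phi> (emA (T (\<alpha> v) - P (T v))) (tj v) + \<phi> (tj v) (emA (T (\<beta> v) - Q (T v)))) = 0"
      by (rule sym)
  qed
  then show ?R1 by simp
next
  assume R: "?R1 \<and> ?R2"
  have z: "\<phi> (emA 0) (tj v) = 0" "\<phi> (tj v) (emA 0) = 0" if "bilinear_form hscale hS \<phi>" for \<phi> v
    by (rule linear_onD(3)[OF bilinear_emA(1)[OF that tj_in_hS]]
        linear_onD(3)[OF bilinear_emA(2)[OF that tj_in_hS]])+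
  show ?L1
  proof (intro allI impI)
    fix \<phi> assume "bilinear_form hscale hS \<phi>"
    from PQ_conditions(1)[OF this] z[OF this] R
    show "lin_ext (\<lambda>(a, b). \<phi> (hQ a) (id b)) skew_rep = lin_ext (\<lambda>(a, b). \<phi> (id a) (hP b)) skew_rep"
      by simp
  qed
  show ?L2
  proof (intro allI impI)
    fix \<phi> assume "bilinear_form hscale hS \<phi>"
    from PQ_conditions(2)[OF this] z[OF this] R
    show "lin_ext (\<lambda>(a, b). \<phi> (hP a) (id b)) skew_rep = lin_ext (\<lambda>(a, b). \<phi> (id a) (hQ b)) skew_rep"
      by simp
  qed
qed

text \<open>Membership in the tensor square and linearity of \<open>T\<close> hold outright; the two
  quadratic equations match the two product conditions, and the two linear ones jointly match those
  on \<open>P\<close> and \<open>Q\<close>.\<close>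

lemma YBE_solution_iff:
  "RPCA_YBE_solution hscale hS hdot hcirc hP hQ
      (coset_diff (map_tensor sA sV B T) (tensor2_flip hscale hS (map_tensor sA sV B T)))
    \<longleftrightarrow> O_operator sA UNIV dot circ P Q \<mu> l r \<alpha> \<beta> sV UNIV T"
proof -
  have "coset (tensor2_null hscale hS) skew_rep \<in> tensor2 hscale hS"
    unfolding tensor2_def using keys_skew_rep by blast
  moreover have "linear_on sV UNIV sA UNIV T"
    by (simp add: linear_on_def T.add T.scale)
  ultimately show ?thesis
    unfolding skew_tensor RPCA_YBE_solution_def O_operator_def YB_A_iff YB_T_iff
      tensor2_map_diff_eq_null_iff[OF hat_bilinear(4) id_linear id_linear hat_bilinear(3)]
      tensor2_map_diff_eq_null_iff[OF hat_bilinear(3) id_linear id_linear hat_bilinear(4)]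
      PQ_iff mult_defect_def circ_defect_def
    by simp
qed

end

theorem theorem4p12:
  fixes sA :: "'k::{field_char_0, alg_closed_field} \<Rightarrow> 'a::ab_group_add \<Rightarrow> 'a"
    and sV :: "'k \<Rightarrow> 'v::ab_group_add \<Rightarrow> 'v"
    and dot circ :: "'a \<Rightarrow> 'a \<Rightarrow> 'a" and P Q :: "'a \<Rightarrow> 'a"
    and \<mu> l r :: "'a \<Rightarrow> 'v \<Rightarrow> 'v" and \<alpha> \<beta> :: "'v \<Rightarrow> 'v"
    and B :: "'v set" and T :: "'v \<Rightarrow> 'a"
  assumes "relative_PCA_algebra sA UNIV dot circ P Q"
    and "relative_PCA_representation sA UNIV dot circ P Q \<mu> l r \<alpha> \<beta> sV UNIV"
    and "finite_dimensional_vector_space sV B"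
    and "Vector_Spaces.linear sV sA T"
  shows "let
      scale' = module_prod.scale sA dual_scale;
      A' = UNIV \<times> dual_space sV;
      dot' = semidirect_mult dot (- dual_rep \<mu>);
      circ' = semidirect_circ circ (dual_rep r - dual_rep l) (dual_rep r);
      P' = map_prod P (transpose_map \<beta>);
      Q' = map_prod Q (transpose_map \<alpha>);
      t = map_tensor sA sV B T
    in relative_PCA_algebra scale' A' dot' circ' P' Q' \<and>
      (RPCA_YBE_solution scale' A' dot' circ' P' Q' (coset_diff t (tensor2_flip scale' A' t))
        \<longleftrightarrow> O_operator sA UNIV dot circ P Q \<mu> l r \<alpha> \<beta> sV UNIV T)"
proof -
  interpret relative_PCA_rep_map sA sV dot circ P Q B \<mu> l r \<alpha> \<beta> T
    using assms
    by (intro relative_PCA_rep_map.intro relative_PCA_rep.intro relative_PCA_rep_axioms.intro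
        relative_PCA_rep_map_axioms.intro)
  show ?thesis
    unfolding Let_def using hat_relative_PCA YBE_solution_iff by blast
qed

end
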